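(* Let $n\ge2$, let $A$ be a parallelotope in $\mathbb{R}^n$ and let $u,v\in S^{n-1}$. Then $$|A|\,|P_{[u,v]^\perp}A|_{n-2}\sqrt{1-\langle u,v\rangle^2}\le|P_{u^\perp}A|_{n-1}\,|P_{v^\perp}A|_{n-1}.$$ Moreover, writing $A=\sum_{i=1}^n[a_i,a_i+w_i]$ with $a_i,w_i\in\mathbb{R}^n$, equality holds if and only if there exist $I\subset\{1,\dots,n\}$ and $\lambda_1,\dots,\lambda_n\in\mathbb{R}$ such that $u=\sum_{i\in I}\lambda_iw_i$ and $v=\sum_{i\in I^c}\lambda_iw_i$.
   Context: A parallelotope in $\mathbb{R}^n$ is a Minkowski sum $\sum_{i=1}^n[a_i,a_i+w_i]$ of $n$ segments with $w_1,\dots,w_n$ linearly independent (an invertible affine image of the cube $[0,1]^n$). $|\cdot|$ is $n$-dimensional volume, $|\cdot|_m$ is $m$-dimensional volume (with $|\cdot|_0=1$ for a point). $P_E$ is the orthogonal projection onto a subspace $E$; $u^\perp$ is the hyperplane orthogonal to $u$; $[u,v]^\perp$ is the orthogonal complement of the span of $u$ and $v$; the left-hand side is $0$ when $u=\pm v$. $I^c$ is the complement of $I$ in $\{1,\dots,n\}$. *)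

theory Defs
  imports "HOL-Analysis.Analysis" "HOL-Library.Set_Algebras"
begin

text \<open>Sums of sets are Minkowski sums (\<^theory>\<open>HOL-Library.Set_Algebras\<close>). The coordinate type
  \<open>'n\<close> also serves as the index set of the \<open>n\<close> segments, so injectivity of \<open>w\<close> together with
  independence of its range says that the family \<open>w\<close> is linearly independent.\<close>

definition parallelotope :: "(real ^ 'n) set \<Rightarrow> bool" where
  "parallelotope A \<longleftrightarrow>
     (\<exists>a w :: 'n \<Rightarrow> real ^ 'n. inj w \<and> independent (range w) \<and>
        A = (\<Sum>i\<in>UNIV. closed_segment (a i) (a i + w i)))"

definition orth_proj :: "'a::euclidean_space set \<Rightarrow> 'a \<Rightarrow> 'a" where
  "orth_proj E x = (THE y. y \<in> E \<and> x - y \<in> E\<^sup>\<bottom>)"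

lemma orth_proj_unique_existence:
  fixes E :: "'a::euclidean_space set"
  assumes "subspace E"
  shows "\<exists>!y. y \<in> E \<and> x - y \<in> E\<^sup>\<bottom>"
proof (rule ex_ex1I)
  obtain y z where "y \<in> span E" "\<And>w. w \<in> span E \<Longrightarrow> orthogonal z w" "x = y + z"
    using orthogonal_subspace_decomp_exists[of E x] by metis
  then have "y \<in> E \<and> x - y \<in> E\<^sup>\<bottom>"
    using assms by (simp add: orthogonal_comp_def span_base orthogonal_commute[of z] span_eq_iff[THEN iffD2])
  then show "\<exists>y. y \<in> E \<and> x - y \<in> E\<^sup>\<bottom>" ..
next
  fix y z assume y: "y \<in> E \<and> x - y \<in> E\<^sup>\<bottom>" and z: "z \<in> E \<and> x - z \<in> E\<^sup>\<bottom>"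
  have "y - z \<in> E" using y z assms by (simp add: subspace_diff)
  then have "(y - z) \<bullet> (x - z) = 0" "(y - z) \<bullet> (x - y) = 0"
    using y z by (auto simp: orthogonal_comp_def orthogonal_def)
  then have "(y - z) \<bullet> (y - z) = 0" by (simp add: inner_diff_right)
  then show "y = z" by simp
qed

definition orthonormal_basis_of :: "'a::euclidean_space set \<Rightarrow> 'a set \<Rightarrow> bool" where
  "orthonormal_basis_of E B \<longleftrightarrow>
     pairwise orthogonal B \<and> (\<forall>b\<in>B. norm b = 1) \<and> span B = E"

lemma orthonormal_basis_of_exists:
  fixes E :: "'a::euclidean_space set"
  assumes "subspace E"
  shows "\<exists>B. orthonormal_basis_of E B"
  using orthonormal_basis_subspace[OF assms] unfolding orthonormal_basis_of_def by metis

text \<open>Lebesgue measure on a linear subspace \<open>E\<close>, as a Borel measure on the ambient space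
  concentrated on \<open>E\<close>: the definition of \<^const>\<open>lborel\<close> with the standard basis replaced by an
  orthonormal basis of \<open>E\<close>. By rotation invariance of Lebesgue measure the result does not depend
  on the basis chosen. If \<open>E = {0}\<close> then the basis is empty and one obtains the point mass at \<open>0\<close>.\<close>

definition lborel_on :: "'a::euclidean_space set \<Rightarrow> 'a measure" where
  "lborel_on E =
     (let B = (SOME B. orthonormal_basis_of E B)
      in distr (\<Pi>\<^sub>M b\<in>B. lborel) borel (\<lambda>f. \<Sum>b\<in>B. f b *\<^sub>R b))"

text \<open>The \<open>m\<close>-dimensional volume of a subset \<open>S\<close> of \<open>E\<close>, where \<open>m = dim E\<close>.\<close>

definition vol_on :: "'a::euclidean_space set \<Rightarrow> 'a set \<Rightarrow> real" where
  "vol_on E S = measure (lborel_on E) S"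

lemma vol_on_point: "vol_on {0 :: 'a::euclidean_space} {0} = 1"
proof -
  have B: "(SOME B. orthonormal_basis_of {0 :: 'a} B) = {}" (is "?B = _")
  proof -
    have "orthonormal_basis_of {0 :: 'a} ?B"
      using orthonormal_basis_of_exists[OF subspace_single_0] by (rule someI_ex)
    then have "?B \<subseteq> {0}" "0 \<notin> ?B"
      using span_superset[of ?B] by (auto simp: orthonormal_basis_of_def)
    then show ?thesis by blast
  qed
  have "emeasure (lborel_on {0 :: 'a}) {0} = 1"
    unfolding lborel_on_def Let_def B
    by (subst emeasure_distr) (auto simp: PiM_empty)
  then show ?thesis by (simp add: vol_on_def measure_def)
qed

end

theory Submission
  imports Defs
begin

text \<open>For a compact convex \<open>K\<close> the volume of \<open>K + [0, te]\<close> is affine in \<open>t \<ge> 0\<close>, since the increments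
  are translates of each other, and for a unit vector \<open>e\<close> its slope is the volume of the shadow of \<open>K\<close>
  along \<open>e\<close>. Hence the volume of a zonotope \<open>\<Sum>[0, t\<^sub>j z\<^sub>j]\<close> is multi-affine in the \<open>t\<^sub>j\<close> as well as
  homogeneous of degree \<open>n\<close>, so it is the sum of the volumes of the parallelotopes spanned by \<open>n\<close> of the
  \<open>z\<^sub>j\<close>. Applied to the segments \<open>w\<^sub>1, \<dots>, w\<^sub>n, u, v\<close> with \<open>u = \<Sum>x\<^sub>i w\<^sub>i\<close> and
  \<open>v = \<Sum>y\<^sub>i w\<^sub>i\<close>, this turns the volumes of the shadows along \<open>u\<close>, along \<open>v\<close>
  and along both (the last one with its factor \<open>sqrt (1 - (u \<bullet> v)\<^sup>2)\<close>), relative to \<open>|A|\<close>, into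
  \<open>\<Sum>|x\<^sub>i|\<close>, \<open>\<Sum>|y\<^sub>i|\<close> and \<open>\<Sum>\<^bsub>i<j\<^esub>|x\<^sub>i y\<^sub>j - x\<^sub>j y\<^sub>i|\<close>. The claim becomes a termwise triangle
  inequality, with equality iff \<open>x\<^sub>i y\<^sub>i = 0\<close> for all \<open>i\<close>.\<close>

section \<open>Volume of a Minkowski sum with a segment\<close>

lemma mem_plus_segment_iff:
  fixes K :: "'a::real_vector set"
  shows "y \<in> K + closed_segment 0 (t *\<^sub>R e) \<longleftrightarrow> (\<exists>x\<in>K. \<exists>r\<in>{0..1}. y = x + (r * t) *\<^sub>R e)"
  by (simp add: set_plus_def closed_segment_def) (metis atLeastAtMost_iff)

lemma mem_plus_segment_scaled_iff:
  fixes K :: "'a::real_vector set"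
  assumes "t \<ge> 0"
  shows "y \<in> K + closed_segment 0 (t *\<^sub>R e) \<longleftrightarrow> (\<exists>x\<in>K. \<exists>r\<in>{0..t}. y = x + r *\<^sub>R e)"
proof
  assume "y \<in> K + closed_segment 0 (t *\<^sub>R e)"
  then obtain x r where "x \<in> K" "r \<in> {0..1}" "y = x + (r * t) *\<^sub>R e"
    by (auto simp: mem_plus_segment_iff)
  moreover have "r * t \<in> {0..t}"
    using assms \<open>r \<in> {0..1}\<close> by (auto simp: mult_left_le_one_le)
  ultimately show "\<exists>x\<in>K. \<exists>r\<in>{0..t}. y = x + r *\<^sub>R e" by blast
next
  assume "\<exists>x\<in>K. \<exists>r\<in>{0..t}. y = x + r *\<^sub>R e"
  then obtain x r where *: "x \<in> K" "r \<in> {0..t}" "y = x + r *\<^sub>R e" by blast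
  show "y \<in> K + closed_segment 0 (t *\<^sub>R e)"
  proof (cases "t = 0")
    case True
    with * show ?thesis by (auto simp: mem_plus_segment_iff)
  next
    case False
    with * assms have "r / t \<in> {0..1}" "y = x + ((r / t) * t) *\<^sub>R e"
      by auto
    with * show ?thesis unfolding mem_plus_segment_iff by blast
  qed
qed

lemma compact_set_plus:
  fixes S T :: "'a::real_normed_vector set"
  assumes "compact S" "compact T"
  shows "compact (S + T)"
proof -
  have "S + T = {x + y |x y. x \<in> S \<and> y \<in> T}"
    unfolding set_plus_def by blast
  then show ?thesis using compact_sums[OF assms] by simp
qed

lemma compact_sum_segments:
  fixes z :: "'i \<Rightarrow> 'a::real_normed_vector"
  shows "compact (\<Sum>i\<in>J. closed_segment (a i) (z i))"
  by (induction J rule: infinite_finite_induct) (auto simp: compact_set_plus set_zero)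

lemma convex_sum_segments:
  fixes z :: "'i \<Rightarrow> 'a::real_normed_vector"
  shows "convex (\<Sum>i\<in>J. closed_segment (a i) (z i))"
  by (induction J rule: infinite_finite_induct) (auto simp: convex_set_plus set_zero)

text \<open>A point gained by the longer segment needs a parameter \<open>r > t\<close>, so moving
  it back by \<open>t\<close> along \<open>e\<close> reaches the first set difference with length
  \<open>s\<close>. The converse uses convexity: if \<open>y'\<close> lies outside \<open>K\<close>
  but its translate were covered by the shorter segment, some \<open>x'\<close> in \<open>K\<close>
  would lie at or beyond \<open>y'\<close> in direction \<open>e\<close>, while \<open>x\<close>
  lies at or before it, which forces \<open>y'\<close> into \<open>K\<close>.\<close>

lemma plus_segment_diff_translate:
  fixes K :: "'a::real_vector set"
  assumes "convex K" "s \<ge> 0" "t \<ge> 0"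
  shows "(K + closed_segment 0 ((t + s) *\<^sub>R e)) - (K + closed_segment 0 (t *\<^sub>R e))
       = (+) (t *\<^sub>R e) ` ((K + closed_segment 0 (s *\<^sub>R e)) - K)" (is "?L = ?R")
proof
  show "?L \<subseteq> ?R"
  proof
    fix y assume y: "y \<in> ?L"
    then obtain x r where x: "x \<in> K" "r \<in> {0..t + s}" "y = x + r *\<^sub>R e"
      using assms by (auto simp: mem_plus_segment_scaled_iff)
    have "r > t"
      using y x assms by (fastforce simp: mem_plus_segment_scaled_iff)
    then have "y - t *\<^sub>R e \<in> K + closed_segment 0 (s *\<^sub>R e)"
      using x assms by (auto simp: mem_plus_segment_scaled_iff algebra_simps intro!: bexI[of _ x] bexI[of _ "r - t"])
    moreover have "y - t *\<^sub>R e \<notin> K"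
    proof
      assume "y - t *\<^sub>R e \<in> K"
      then have "y \<in> K + closed_segment 0 (t *\<^sub>R e)"
        using assms unfolding mem_plus_segment_scaled_iff[OF \<open>t \<ge> 0\<close>]
        by (intro bexI[of _ "y - t *\<^sub>R e"] bexI[of _ t]) auto
      with y show False by blast
    qed
    ultimately show "y \<in> ?R"
      by (intro image_eqI[of _ _ "y - t *\<^sub>R e"]) auto
  qed
  show "?R \<subseteq> ?L"
  proof
    fix y assume "y \<in> ?R"
    then obtain y' where y: "y = t *\<^sub>R e + y'" and y': "y' \<in> K + closed_segment 0 (s *\<^sub>R e)" "y' \<notin> K"
      by blast
    from y' obtain x r where x: "x \<in> K" "r \<in> {0..s}" "y' = x + r *\<^sub>R e"
      using assms by (auto simp: mem_plus_segment_scaled_iff)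
    have "y \<in> K + closed_segment 0 ((t + s) *\<^sub>R e)"
      using assms x y by (subst mem_plus_segment_scaled_iff)
        (auto intro!: bexI[of _ x] bexI[of _ "t + r"] simp: algebra_simps)
    moreover have "y \<notin> K + closed_segment 0 (t *\<^sub>R e)"
    proof
      assume "y \<in> K + closed_segment 0 (t *\<^sub>R e)"
      then obtain x' r' where x': "x' \<in> K" "r' \<in> {0..t}" "y = x' + r' *\<^sub>R e"
        using assms by (auto simp: mem_plus_segment_scaled_iff)
      define q where "q = t - r'"
      have q: "q \<ge> 0" "x' = y' + q *\<^sub>R e"
        using x' y by (auto simp: q_def algebra_simps)
      have "y' \<in> K"
      proof (cases "q + r = 0")
        case True
        then have "r = 0" using q x by auto
        then show ?thesis using x by auto
      next
        case False
        with q x have pos: "q + r > 0" by auto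
        \<comment> \<open>On the line through \<open>y'\<close> in direction \<open>e\<close> the
          points \<open>x\<close> and \<open>x'\<close> sit at parameters \<open>-r\<close> and
          \<open>q\<close>; these weights balance them at \<open>y'\<close>.\<close>
        define a b where "a = r / (q + r)" and "b = q / (q + r)"
        have ab: "a \<ge> 0" "b \<ge> 0" "a + b = 1" "a * (q + r) = r"
          using q x pos by (auto simp: a_def b_def simp flip: add_divide_distrib)
        have "a *\<^sub>R x' + b *\<^sub>R x = (a + b) *\<^sub>R x + (a * (q + r)) *\<^sub>R e"
          unfolding q(2) x(3) by (simp add: algebra_simps)
        also have "\<dots> = y'"
          using ab x by simp
        finally show ?thesis
          using convexD[OF assms(1) x'(1) x(1) ab(1-3)] by simp
      qed
      with y' show False by simp
    qed
    ultimately show "y \<in> ?L" by blast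
  qed
qed

text \<open>Cauchy's functional equation on the half line. Nonnegativity makes an additive
  \<open>h\<close> monotone; squeezing \<open>real N * t\<close> between consecutive integers then
  bounds \<open>N\<close> times the defect by \<open>h 1\<close> for every \<open>N\<close>, so the
  defect is zero.\<close>

lemma additive_nonneg_imp_linear:
  fixes h :: "real \<Rightarrow> real"
  assumes add: "\<And>s t. s \<ge> 0 \<Longrightarrow> t \<ge> 0 \<Longrightarrow> h (s + t) = h s + h t"
    and nonneg: "\<And>t. t \<ge> 0 \<Longrightarrow> h t \<ge> 0" and "t \<ge> 0"
  shows "h t = t * h 1"
proof -
  have mono: "h s \<le> h t" if "0 \<le> s" "s \<le> t" for s t
    using add[of s "t - s"] nonneg[of "t - s"] that by simp
  have h0: "h 0 = 0" using add[of 0 0] by simp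
  have mult: "h (real N * s) = real N * h s" if "s \<ge> 0" for N s
    using that by (induction N) (auto simp: h0 add algebra_simps)
  have bound: "real N * \<bar>h t - t * h 1\<bar> \<le> h 1" for N
  proof -
    define k where "k = nat \<lfloor>real N * t\<rfloor>"
    have k: "real k \<le> real N * t" "real N * t \<le> real (Suc k)"
      using \<open>t \<ge> 0\<close> by (auto simp: k_def) linarith?
    have "real k * h 1 \<le> real N * h t"
      using mono[of "real k" "real N * t"] mult[of 1 k] mult[of t N] k \<open>t \<ge> 0\<close> by simp
    moreover have "real N * h t \<le> real (Suc k) * h 1"
      using mono[of "real N * t" "real (Suc k)"] mult[of 1 "Suc k"] mult[of t N] k \<open>t \<ge> 0\<close> by simp
    moreover have "real k * h 1 \<le> real N * t * h 1" "real N * t * h 1 \<le> real (Suc k) * h 1"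
      using k nonneg[of 1] by (auto intro!: mult_right_mono simp del: of_nat_Suc)
    ultimately have "\<bar>real N * h t - real N * t * h 1\<bar> \<le> h 1"
      by (simp add: algebra_simps abs_le_iff)
    then have "\<bar>real N * (h t - t * h 1)\<bar> \<le> h 1"
      by (simp add: algebra_simps)
    then show ?thesis by (simp add: abs_mult)
  qed
  show ?thesis
  proof (rule ccontr)
    assume "h t \<noteq> t * h 1"
    then have "\<bar>h t - t * h 1\<bar> > 0" by simp
    then obtain N where "h 1 < real N * \<bar>h t - t * h 1\<bar>"
      using reals_Archimedean3 by blast
    with bound[of N] show False by simp
  qed
qed

text \<open>The increment \<open>h\<close> is additive in \<open>t\<close> by
  \<open>plus_segment_diff_translate\<close> and translation invariance, and nonnegative by
  inclusion, hence linear. The slope is kept as the increment at \<open>t = 1\<close>; the next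
  result gives its geometric meaning.\<close>

proposition measure_plus_segment_affine:
  fixes K :: "'a::euclidean_space set"
  assumes K: "compact K" "convex K" and "t \<ge> 0"
  shows "measure lebesgue (K + closed_segment 0 (t *\<^sub>R e)) = measure lebesgue K
      + t * (measure lebesgue (K + closed_segment 0 e) - measure lebesgue K)"
proof -
  define h where "h t = measure lebesgue (K + closed_segment 0 (t *\<^sub>R e)) - measure lebesgue K" for t
  have lm: "K + closed_segment 0 (t *\<^sub>R e) \<in> lmeasurable" for t
    using K by (intro lmeasurable_compact compact_set_plus) auto
  have K_lm: "K \<in> lmeasurable" using K by (simp add: lmeasurable_compact)
  have sub: "K + closed_segment 0 (s *\<^sub>R e) \<subseteq> K + closed_segment 0 (t *\<^sub>R e)" if "0 \<le> s" "s \<le> t" for s t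
    using that by (fastforce simp: mem_plus_segment_scaled_iff)
  have sub0: "K \<subseteq> K + closed_segment 0 (t *\<^sub>R e)" for t
    by (intro set_zero_plus2[of "closed_segment 0 (t *\<^sub>R e)" K, unfolded add.commute[of _ K]]) simp
  have "h (s + t) = h s + h t" if "s \<ge> 0" "t \<ge> 0" for s t
  proof -
    have "measure lebesgue ((K + closed_segment 0 ((t + s) *\<^sub>R e)) - (K + closed_segment 0 (t *\<^sub>R e)))
        = measure lebesgue ((K + closed_segment 0 (s *\<^sub>R e)) - K)"
      using that K by (simp add: plus_segment_diff_translate measure_translation)
    then show ?thesis
      using that by (simp add: measure_Diff lm K_lm fmeasurableD sub sub0 h_def add.commute
          measurable_measure_Diff)
  qed
  moreover have "h t \<ge> 0" for t
    unfolding h_def using measure_mono_fmeasurable[OF sub0 _ lm] K_lm by (simp add: fmeasurableD)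
  ultimately have "h t = t * h 1"
    using \<open>t \<ge> 0\<close> by (intro additive_nonneg_imp_linear) auto
  then show ?thesis by (simp add: h_def)
qed

text \<open>The shadow \<open>PK\<close> is thickened to height 1 along \<open>e\<close>, so that
  its volume is measured in full dimension. Sweeping \<open>K\<close> and sweeping \<open>PK\<close>
  along \<open>e\<close> give volumes affine in \<open>t\<close>; each swept body fits, after a
  shift, into the other one with a segment longer by a constant. For large \<open>t\<close> this
  forces equal slopes, and \<open>PK\<close> itself is null.\<close>

proposition measure_plus_segment_orthogonal:
  fixes K :: "'a::euclidean_space set"
  assumes K: "compact K" "convex K" and e: "norm e = 1" and "t \<ge> 0"
  defines "PK \<equiv> (\<lambda>x. x - (x \<bullet> e) *\<^sub>R e) ` K"
  shows "measure lebesgue (K + closed_segment 0 (t *\<^sub>R e))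
       = measure lebesgue K + t * measure lebesgue (PK + closed_segment 0 e)"
proof -
  have lin: "linear (\<lambda>x. x - (x \<bullet> e) *\<^sub>R e)"
    by (auto intro!: linearI simp: algebra_simps)
  have PK: "compact PK" "convex PK"
    using K lin unfolding PK_def
    by (auto intro!: compact_continuous_image linear_continuous_on convex_linear_image simp: linear_linear)
  have "PK \<subseteq> {x. e \<bullet> x = 0}"
    using norm_eq_1[of e] e by (auto simp: PK_def inner_diff_right inner_commute)
  moreover have "negligible {x. e \<bullet> x = 0}"
    using e by (intro negligible_hyperplane) auto
  ultimately have PK0: "measure lebesgue PK = 0"
    using negligible_imp_measure0 negligible_subset by blast
  obtain R where R: "\<And>x. x \<in> K \<Longrightarrow> norm x \<le> R" "R > 0"
    using compact_imp_bounded[OF K(1)] by (auto simp: bounded_pos)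
  have R': "\<bar>x \<bullet> e\<bar> \<le> R" if "x \<in> K" for x
    using Cauchy_Schwarz_ineq2[of x e] R(1)[OF that] e by simp
  define c where "c = measure lebesgue (K + closed_segment 0 e) - measure lebesgue K"
  define d where "d = measure lebesgue (PK + closed_segment 0 e)"
  have Kt: "measure lebesgue (K + closed_segment 0 (t *\<^sub>R e)) = measure lebesgue K + t * c" if "t \<ge> 0" for t
    using that K by (simp add: c_def measure_plus_segment_affine[of K t])
  have PKt: "measure lebesgue (PK + closed_segment 0 (t *\<^sub>R e)) = t * d" if "t \<ge> 0" for t
    using that PK by (simp add: d_def PK0 measure_plus_segment_affine[of PK t])
  have lm: "C + closed_segment 0 (t *\<^sub>R e) \<in> lmeasurable" if "compact C" for t C
    using that by (intro lmeasurable_compact compact_set_plus) auto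
  \<comment> \<open>A point of \<open>K\<close> and its projection differ by a multiple of
    \<open>e\<close> of size at most \<open>R\<close>. The shift by \<open>R\<close> makes this
    offset nonnegative, and the extra length \<open>2 * R\<close> absorbs it.\<close>
  have 1: "measure lebesgue K + t * c \<le> (t + 2 * R) * d" if t: "t \<ge> 0" for t
  proof -
    have "(+) (R *\<^sub>R e) ` (K + closed_segment 0 (t *\<^sub>R e)) \<subseteq> PK + closed_segment 0 ((t + 2 * R) *\<^sub>R e)"
    proof
      fix y assume "y \<in> (+) (R *\<^sub>R e) ` (K + closed_segment 0 (t *\<^sub>R e))"
      then obtain y' where "y' \<in> K + closed_segment 0 (t *\<^sub>R e)" "y = R *\<^sub>R e + y'" by blast
      then obtain x r where x: "x \<in> K" "r \<in> {0..t}" "y = R *\<^sub>R e + (x + r *\<^sub>R e)"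
        unfolding mem_plus_segment_scaled_iff[OF t] by blast
      then have "y = (x - (x \<bullet> e) *\<^sub>R e) + (R + r + x \<bullet> e) *\<^sub>R e"
        by (simp add: algebra_simps)
      moreover have "R + r + x \<bullet> e \<in> {0..t + 2 * R}"
        using x R'[of x] by (auto simp: abs_le_iff)
      ultimately show "y \<in> PK + closed_segment 0 ((t + 2 * R) *\<^sub>R e)"
        unfolding PK_def using x(1) set_plus_intro[of "x - (x \<bullet> e) *\<^sub>R e" _ "(R + r + x \<bullet> e) *\<^sub>R e"]
          mem_plus_segment_scaled_iff[of "t + 2 * R" "(R + r + x \<bullet> e) *\<^sub>R e" 0 e] that \<open>R > 0\<close>
        by fastforce
    qed
    then have "measure lebesgue ((+) (R *\<^sub>R e) ` (K + closed_segment 0 (t *\<^sub>R e)))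
        \<le> measure lebesgue (PK + closed_segment 0 ((t + 2 * R) *\<^sub>R e))"
      using lm[OF K(1), of t] lm[OF PK(1), of "t + 2 * R"]
      by (intro measure_mono_fmeasurable) (auto simp: fmeasurableD measurable_translation)
    then show ?thesis
      using that \<open>R > 0\<close> by (simp add: measure_translation Kt PKt)
  qed
  have 2: "t * d \<le> measure lebesgue K + (t + 2 * R) * c" if t: "t \<ge> 0" for t
  proof -
    have "(+) (R *\<^sub>R e) ` (PK + closed_segment 0 (t *\<^sub>R e)) \<subseteq> K + closed_segment 0 ((t + 2 * R) *\<^sub>R e)"
    proof
      fix y assume "y \<in> (+) (R *\<^sub>R e) ` (PK + closed_segment 0 (t *\<^sub>R e))"
      then obtain y' where "y' \<in> PK + closed_segment 0 (t *\<^sub>R e)" "y = R *\<^sub>R e + y'" by blast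
      then obtain x r where x: "x \<in> K" "r \<in> {0..t}" "y = R *\<^sub>R e + ((x - (x \<bullet> e) *\<^sub>R e) + r *\<^sub>R e)"
        unfolding mem_plus_segment_scaled_iff[OF t] PK_def by blast
      then have "y = x + (R + r - x \<bullet> e) *\<^sub>R e"
        by (simp add: algebra_simps)
      moreover have "R + r - x \<bullet> e \<in> {0..t + 2 * R}"
        using x R'[of x] by (auto simp: abs_le_iff)
      ultimately show "y \<in> K + closed_segment 0 ((t + 2 * R) *\<^sub>R e)"
        using x(1) that \<open>R > 0\<close> by (subst mem_plus_segment_scaled_iff)
          (auto intro!: bexI[of _ x] bexI[of _ "R + r - x \<bullet> e"])
    qed
    then have "measure lebesgue ((+) (R *\<^sub>R e) ` (PK + closed_segment 0 (t *\<^sub>R e)))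
        \<le> measure lebesgue (K + closed_segment 0 ((t + 2 * R) *\<^sub>R e))"
      using lm[OF PK(1), of t] lm[OF K(1), of "t + 2 * R"]
      by (intro measure_mono_fmeasurable) (auto simp: fmeasurableD measurable_translation)
    then show ?thesis
      using that \<open>R > 0\<close> by (simp add: measure_translation Kt PKt)
  qed
  \<comment> \<open>A linear function bounded above on the half line has slope at most 0. Below,
    \<open>x\<close> is the difference of the two slopes and \<open>C\<close> collects the terms
    free of \<open>t\<close>.\<close>
  have small: "x \<le> 0" if "\<And>t. t \<ge> 0 \<Longrightarrow> t * x \<le> C" for x C :: real
  proof (rule ccontr)
    assume "\<not> x \<le> 0"
    then have "(\<bar>C\<bar> + 1) / x * x \<le> C" by (intro that) auto
    with \<open>\<not> x \<le> 0\<close> show False by simp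
  qed
  have "c - d \<le> 0"
    using 1 by (intro small[of _ "2 * R * d - measure lebesgue K"]) (simp add: algebra_simps)
  moreover have "d - c \<le> 0"
    using 2 by (intro small[of _ "2 * R * c + measure lebesgue K"]) (simp add: algebra_simps)
  ultimately have "c = d" by simp
  then show ?thesis using Kt[OF \<open>t \<ge> 0\<close>] by (simp add: d_def)
qed

section \<open>Volume on subspaces\<close>

lemma sum_segments_eq:
  fixes z :: "'i \<Rightarrow> 'a::real_vector"
  assumes "finite I"
  shows "(\<Sum>i\<in>I. closed_segment 0 (z i)) = {(\<Sum>i\<in>I. r i *\<^sub>R z i) |r. \<forall>i\<in>I. r i \<in> {0..1}}"
proof (intro equalityI subsetI)
  fix x assume "x \<in> (\<Sum>i\<in>I. closed_segment 0 (z i))"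
  then obtain s where s: "x = sum s I" "\<forall>i\<in>I. s i \<in> closed_segment 0 (z i)"
    using assms by (auto simp: set_sum_alt)
  have "\<forall>i\<in>I. \<exists>r\<in>{0..1}. s i = r *\<^sub>R z i"
    using s(2) by (simp add: closed_segment_def) (metis atLeastAtMost_iff)
  then obtain r where "\<forall>i\<in>I. r i \<in> {0..1::real} \<and> s i = r i *\<^sub>R z i" by metis
  then show "x \<in> {(\<Sum>i\<in>I. r i *\<^sub>R z i) |r. \<forall>i\<in>I. r i \<in> {0..1}}"
    using s by (auto intro!: exI[of _ r])
next
  fix x assume "x \<in> {(\<Sum>i\<in>I. r i *\<^sub>R z i) |r. \<forall>i\<in>I. r i \<in> {0..1}}"
  then obtain r where "x = (\<Sum>i\<in>I. r i *\<^sub>R z i)" "\<forall>i\<in>I. r i \<in> {0..1::real}" by blast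
  then show "x \<in> (\<Sum>i\<in>I. closed_segment 0 (z i))"
    unfolding set_sum_alt[OF assms] closed_segment_def by (auto intro!: exI[of _ "\<lambda>i. r i *\<^sub>R z i"])
qed

text \<open>The edges are rescaled one at a time, \<open>J\<close> being the set already treated.
  The sum \<open>K\<close> of the other edges lies in the hyperplane orthogonal to
  \<open>z j\<close>, so it is null and the affine law becomes proportionality to
  \<open>t j\<close>. The volume of the unit cube on the \<open>z i\<close> stays an unknown
  factor.\<close>

lemma measure_orthonormal_box:
  fixes z :: "'i \<Rightarrow> 'a::euclidean_space"
  assumes "finite I" and z: "\<And>i j. i \<in> I \<Longrightarrow> j \<in> I \<Longrightarrow> z i \<bullet> z j = (if i = j then 1 else 0)"
    and t: "\<And>i. i \<in> I \<Longrightarrow> t i \<ge> 0"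
  shows "measure lebesgue (\<Sum>i\<in>I. closed_segment 0 (t i *\<^sub>R z i))
       = (\<Prod>i\<in>I. t i) * measure lebesgue (\<Sum>i\<in>I. closed_segment 0 (z i))"
proof -
  have "measure lebesgue (\<Sum>i\<in>I. closed_segment 0 ((if i \<in> J then t i else 1) *\<^sub>R z i))
       = (\<Prod>i\<in>J. t i) * measure lebesgue (\<Sum>i\<in>I. closed_segment 0 (z i))" if "finite J" "J \<subseteq> I" for J
    using that
  proof (induction J)
    case (insert j J)
    define y where "y i = (if i \<in> J then t i else 1) *\<^sub>R z i" for i
    define K where "K = (\<Sum>i\<in>I - {j}. closed_segment 0 (y i))"
    have j: "j \<in> I" "j \<notin> J" using insert by auto
    have "K \<subseteq> {x. z j \<bullet> x = 0}"
      using \<open>finite I\<close> j by (auto simp: K_def sum_segments_eq inner_sum_right y_def z split: if_splits intro!: sum.neutral)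
    moreover have "z j \<noteq> 0" using z[OF j(1) j(1)] by auto
    ultimately have "negligible K"
      using negligible_hyperplane negligible_subset by blast
    then have K0: "measure lebesgue K = 0" by (rule negligible_imp_measure0)
    have K: "compact K" "convex K"
      by (auto simp: K_def compact_sum_segments convex_sum_segments)
    have "(\<Sum>i\<in>I. closed_segment 0 ((if i \<in> insert j J then t i else 1) *\<^sub>R z i))
        = closed_segment 0 (t j *\<^sub>R z j) + K"
      using \<open>finite I\<close> j unfolding K_def y_def
      by (subst sum.remove[of I j]) (auto intro!: arg_cong2[of _ _ _ _ "(+)"] sum.cong)
    moreover have "(\<Sum>i\<in>I. closed_segment 0 (y i)) = closed_segment 0 (z j) + K"
      using \<open>finite I\<close> j unfolding K_def by (subst sum.remove[of I j]) (auto simp: y_def)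
    ultimately show ?case
      using insert measure_plus_segment_affine[OF K t[OF j(1)], of "z j"]
      by (simp add: K0 add.commute[of _ K] flip: y_def)
  qed simp
  from this[OF \<open>finite I\<close>] show ?thesis
    by (simp cong: sum.cong)
qed

text \<open>By \<open>measure_orthonormal_box\<close> the image of every box has \<open>m\<close>
  times its volume, with one constant \<open>m\<close>; this extends to all sets of finite measure.
  The unit ball is mapped onto itself and has positive volume, so \<open>m = 1\<close>.\<close>

lemma measure_orthogonal_transformation:
  fixes T :: "'a::euclidean_space \<Rightarrow> 'a"
  assumes T: "orthogonal_transformation T" and S: "S \<in> lmeasurable"
  shows "measure lebesgue (T ` S) = measure lebesgue S"
proof -
  define m where "m = measure lebesgue (\<Sum>i\<in>Basis. closed_segment 0 (T i))"
  have lin: "linear T" using T by (rule orthogonal_transformation_linear)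
  have cbox: "measure lebesgue (T ` cbox a b) = m * measure lebesgue (cbox a b)" for a b
  proof (cases "cbox a b = {}")
    case False
    then have ab: "a \<bullet> i \<le> b \<bullet> i" if "i \<in> Basis" for i
      using that by (simp add: box_ne_empty)
    have "T ` cbox a b = (+) (T a) ` (\<Sum>i\<in>Basis. closed_segment 0 (((b - a) \<bullet> i) *\<^sub>R T i))"
    proof (intro equalityI subsetI)
      fix y assume "y \<in> T ` cbox a b"
      then obtain x where x: "x \<in> cbox a b" "y = T x" by blast
      \<comment> \<open>The relative position of \<open>x\<close> along each edge. On an edge of
        length 0 the quotient is 0, which is correct since \<open>x\<close> and \<open>a\<close>
        then agree in that coordinate.\<close>
      define r where "r i = ((x - a) \<bullet> i) / ((b - a) \<bullet> i)" for i
      have r: "r i \<in> {0..1} \<and> r i * ((b - a) \<bullet> i) = (x - a) \<bullet> i" if "i \<in> Basis" for i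
        using x(1) ab[OF that] that
        by (cases "(b - a) \<bullet> i = 0") (auto simp: r_def mem_box inner_diff_left divide_simps)
      have "y = T a + T (\<Sum>i\<in>Basis. ((x - a) \<bullet> i) *\<^sub>R i)"
        using lin x(2) by (simp add: euclidean_representation linear_diff)
      also have "T (\<Sum>i\<in>Basis. ((x - a) \<bullet> i) *\<^sub>R i) = (\<Sum>i\<in>Basis. r i *\<^sub>R ((b - a) \<bullet> i) *\<^sub>R T i)"
        using lin r by (auto simp: linear_sum linear_scale intro!: sum.cong)
      finally show "y \<in> (+) (T a) ` (\<Sum>i\<in>Basis. closed_segment 0 (((b - a) \<bullet> i) *\<^sub>R T i))"
        using r unfolding sum_segments_eq[OF finite_Basis] by blast
    next
      fix y assume "y \<in> (+) (T a) ` (\<Sum>i\<in>Basis. closed_segment 0 (((b - a) \<bullet> i) *\<^sub>R T i))"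
      then obtain r where r: "\<And>i. i \<in> Basis \<Longrightarrow> r i \<in> {0..1}"
        and y: "y = T a + (\<Sum>i\<in>Basis. r i *\<^sub>R ((b - a) \<bullet> i) *\<^sub>R T i)"
        unfolding sum_segments_eq[OF finite_Basis] by blast
      define x where "x = a + (\<Sum>i\<in>Basis. (r i * ((b - a) \<bullet> i)) *\<^sub>R i)"
      have "x \<bullet> i = a \<bullet> i + r i * ((b - a) \<bullet> i)" if "i \<in> Basis" for i
        using that by (simp add: x_def inner_add_left)
      moreover have "0 \<le> r i * ((b - a) \<bullet> i) \<and> r i * ((b - a) \<bullet> i) \<le> (b - a) \<bullet> i" if "i \<in> Basis" for i
        using r[OF that] ab[OF that] by (auto simp: inner_diff_left mult_left_le_one_le)
      ultimately have "x \<in> cbox a b"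
        by (fastforce simp: mem_box inner_diff_left)
      moreover have "y = T x"
        using lin by (simp add: y x_def linear_add linear_sum linear_scale)
      ultimately show "y \<in> T ` cbox a b" by blast
    qed
    then have "measure lebesgue (T ` cbox a b)
        = measure lebesgue (\<Sum>i\<in>Basis. closed_segment 0 (((b - a) \<bullet> i) *\<^sub>R T i))"
      by (simp add: measure_translation)
    also have "\<dots> = (\<Prod>i\<in>Basis. (b - a) \<bullet> i) * m"
      unfolding m_def using ab T
      by (intro measure_orthonormal_box) (auto simp: inner_diff_left orthogonal_transformation_def inner_Basis)
    also have "(\<Prod>i\<in>Basis. (b - a) \<bullet> i) = measure lebesgue (cbox a b)"
      using ab by (simp add: measure_completion)
    finally show ?thesis by simp
  qed simp
  have scale: "measure lebesgue (T ` S) = m * measure lebesgue S" if "S \<in> lmeasurable" for S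
    using measure_linear_sufficient[OF lin that cbox] by simp
  have "T ` cball 0 1 = cball 0 1"
    using T by (simp add: image_orthogonal_transformation_cball linear_0[OF lin])
  then have "measure lebesgue (cball (0::'a) 1) = m * measure lebesgue (cball (0::'a) 1)"
    using scale[of "cball 0 1"] by simp
  moreover have "measure lebesgue (cball (0::'a) 1) > 0"
    by (simp add: content_cball_pos measure_completion)
  ultimately have "m = 1" by simp
  with scale[OF S] show ?thesis by simp
qed

text \<open>Lebesgue measure is determined by its values on open boxes. The preimage of a box is
  bounded and open, so the invariance of finite volumes applies to it.\<close>

lemma lborel_orthogonal_transformation:
  fixes T :: "'a::euclidean_space \<Rightarrow> 'a"
  assumes T: "orthogonal_transformation T"
  shows "distr lborel borel T = lborel"
proof -
  have lin: "linear T" using T by (rule orthogonal_transformation_linear)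
  have T_borel: "T \<in> borel_measurable borel"
    using lin by (intro borel_measurable_continuous_onI linear_continuous_on) (simp add: linear_linear)
  have "lborel = distr lborel borel T"
  proof (rule lborel_eqI)
    fix l u :: 'a assume lu: "\<And>b. b \<in> Basis \<Longrightarrow> l \<bullet> b \<le> u \<bullet> b"
    have bij: "bij T" using T by (rule orthogonal_transformation_bij)
    have "open (T -` box l u)"
      using lin by (intro open_vimage) (auto intro!: linear_continuous_on simp: linear_linear)
    moreover have "bounded (T -` box l u)"
    proof -
      have "bounded (T ` (T -` box l u))"
        using bij by (simp add: bij_def)
      then show ?thesis
        using T unfolding bounded_iff by (metis imageI orthogonal_transformation_norm)
    qed
    ultimately have lm: "T -` box l u \<in> lmeasurable" and borel: "T -` box l u \<in> sets borel"
      by (auto simp: lmeasurable_open)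
    have "emeasure (distr lborel borel T) (box l u) = emeasure lborel (T -` box l u)"
      using T_borel by (subst emeasure_distr) auto
    also have "\<dots> = emeasure lebesgue (T -` box l u)"
      using borel by simp
    also have "\<dots> = ennreal (measure lebesgue (T -` box l u))"
      using lm by (simp add: emeasure_eq_measure2)
    also have "measure lebesgue (T -` box l u) = measure lebesgue (T ` (T -` box l u))"
      using measure_orthogonal_transformation[OF T lm] by simp
    also have "T ` (T -` box l u) = box l u"
      using bij by (simp add: bij_def)
    also have "ennreal (measure lebesgue (box l u)) = (\<Prod>b\<in>Basis. (u - l) \<bullet> b)"
      using lu by (subst measure_completion) auto
    finally show "emeasure (distr lborel borel T) (box l u) = (\<Prod>b\<in>Basis. (u - l) \<bullet> b)" .
  qed simp
  then show ?thesis by simp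
qed

text \<open>Measurable rectangles determine the product measure, and renaming coordinates turns a
  rectangle into one with permuted sides. This is used to pass from \<open>Basis\<close> to another
  orthonormal basis as index set.\<close>

lemma PiM_reindex_bij_betw:
  fixes M :: "'b measure"
  assumes "sigma_finite_measure M" "finite I" "bij_betw \<sigma> I D"
  shows "distr (\<Pi>\<^sub>M d\<in>D. M) (\<Pi>\<^sub>M i\<in>I. M) (\<lambda>f. \<lambda>i\<in>I. f (\<sigma> i)) = (\<Pi>\<^sub>M i\<in>I. M)"
proof -
  interpret sigma_finite_measure M by fact
  interpret product_sigma_finite "\<lambda>_. M" by standard
  have D: "finite D" "\<sigma> ` I = D" "inj_on \<sigma> I"
    using assms by (auto simp: bij_betw_def)
  have meas: "(\<lambda>f. \<lambda>i\<in>I. f (\<sigma> i)) \<in> measurable (\<Pi>\<^sub>M d\<in>D. M) (\<Pi>\<^sub>M i\<in>I. M)"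
    using D by (intro measurable_restrict measurable_component_singleton) auto
  show ?thesis
  proof (rule PiM_eqI)
    fix A assume A: "\<And>i. i \<in> I \<Longrightarrow> A i \<in> sets M"
    have "(\<lambda>f. \<lambda>i\<in>I. f (\<sigma> i)) -` Pi\<^sub>E I A \<inter> space (\<Pi>\<^sub>M d\<in>D. M)
        = (\<Pi>\<^sub>E d\<in>D. A (the_inv_into I \<sigma> d))"
    proof -
      have "f d \<in> space M" if "d \<in> D" "\<forall>d\<in>D. f d \<in> A (the_inv_into I \<sigma> d)" for f d
        using that A[THEN sets.sets_into_space] D by (metis in_mono the_inv_into_into subset_refl)
      then show ?thesis
        unfolding D(2)[symmetric] using D(3)
        by (auto simp: space_PiM PiE_iff the_inv_into_f_f)
    qed
    moreover have "emeasure (\<Pi>\<^sub>M d\<in>D. M) (\<Pi>\<^sub>E d\<in>D. A (the_inv_into I \<sigma> d))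
        = (\<Prod>d\<in>D. emeasure M (A (the_inv_into I \<sigma> d)))"
      using A D by (intro emeasure_PiM) (auto simp: the_inv_into_f_f)
    moreover have "\<dots> = (\<Prod>i\<in>I. emeasure M (A i))"
      using D(2,3) by (simp add: prod.reindex the_inv_into_f_f flip: D(2))
    ultimately show "emeasure (distr (\<Pi>\<^sub>M d\<in>D. M) (\<Pi>\<^sub>M i\<in>I. M) (\<lambda>f. \<lambda>i\<in>I. f (\<sigma> i))) (Pi\<^sub>E I A)
        = (\<Prod>i\<in>I. emeasure M (A i))"
      using A \<open>finite I\<close> meas by (subst emeasure_distr) (auto intro!: sets_PiM_I_finite)
  qed (use assms in auto)
qed

lemma borel_measurable_linear_combination [measurable]:
  fixes D :: "'a::euclidean_space set"
  assumes "B \<subseteq> D"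
  shows "(\<lambda>f. \<Sum>b\<in>B. f b *\<^sub>R b) \<in> borel_measurable (\<Pi>\<^sub>M b\<in>D. (lborel :: real measure))"
  using assms by (intro borel_measurable_sum borel_measurable_scaleR) auto

text \<open>A bijection from \<open>Basis\<close> to \<open>D\<close> extends linearly to an
  orthogonal transformation \<open>T\<close>. Pushing the defining formula of \<open>lborel\<close>
  forward along \<open>T\<close>, which preserves \<open>lborel\<close>, and renaming the
  coordinates replaces \<open>Basis\<close> by \<open>D\<close>.\<close>

lemma lborel_eq_orthonormal:
  fixes D :: "'a::euclidean_space set"
  assumes "orthonormal_basis_of UNIV D"
  shows "lborel = distr (\<Pi>\<^sub>M b\<in>D. lborel) borel (\<lambda>f. \<Sum>b\<in>D. f b *\<^sub>R b)"
proof -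
  have D: "pairwise orthogonal D" "\<And>b. b \<in> D \<Longrightarrow> norm b = 1" "span D = UNIV"
    using assms by (auto simp: orthonormal_basis_of_def)
  then have "independent D"
    by (metis norm_zero pairwise_orthogonal_independent zero_neq_one)
  with D have "card D = DIM('a)" "finite D"
    using dim_eq_card[of D UNIV] independent_imp_finite by (auto simp: dim_UNIV)
  then obtain \<sigma> where \<sigma>: "bij_betw \<sigma> (Basis :: 'a set) D"
    using finite_same_card_bij[of Basis D] by auto
  define T where "T x = (\<Sum>b\<in>Basis. (x \<bullet> b) *\<^sub>R \<sigma> b)" for x :: "'a"
  have \<sigma>_inner: "\<sigma> b \<bullet> \<sigma> c = b \<bullet> c" if "b \<in> Basis" "c \<in> Basis" for b c
  proof (cases "b = c")
    case True
    then show ?thesis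
      using that \<sigma> D(2)[of "\<sigma> b"] norm_eq_1[of "\<sigma> b"] by (auto simp: bij_betw_def)
  next
    case False
    then have "\<sigma> b \<noteq> \<sigma> c" "\<sigma> b \<in> D" "\<sigma> c \<in> D"
      using that \<sigma> by (auto simp: bij_betw_def inj_on_def)
    with D(1) have "orthogonal (\<sigma> b) (\<sigma> c)" by (auto simp: pairwise_def)
    with False that show ?thesis by (simp add: orthogonal_def inner_Basis)
  qed
  have lin: "linear T"
    by (auto intro!: linearI simp: T_def inner_add_left scaleR_add_left sum.distrib scaleR_sum_right)
  have T_\<sigma>: "T y \<bullet> \<sigma> b = y \<bullet> b" if "b \<in> Basis" for y b
  proof -
    have "T y \<bullet> \<sigma> b = (\<Sum>c\<in>Basis. (y \<bullet> c) *\<^sub>R c) \<bullet> b"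
      using that unfolding T_def inner_sum_left by (intro sum.cong) (auto simp: \<sigma>_inner)
    then show ?thesis by (simp add: euclidean_representation)
  qed
  have "T x \<bullet> T y = x \<bullet> y" for x y
  proof -
    have "T x \<bullet> T y = (\<Sum>b\<in>Basis. (x \<bullet> b) * (T y \<bullet> \<sigma> b))"
      unfolding T_def[of x] inner_sum_left by (simp add: inner_commute)
    also have "\<dots> = x \<bullet> y"
      by (simp add: T_\<sigma> euclidean_inner[of x y])
    finally show ?thesis .
  qed
  with lin have orth: "orthogonal_transformation T"
    by (simp add: orthogonal_transformation_def)
  have T_borel: "T \<in> borel_measurable borel"
    using lin by (intro borel_measurable_continuous_onI linear_continuous_on) (simp add: linear_linear)
  have T_sum: "T (\<Sum>b\<in>Basis. (\<lambda>i\<in>Basis. f (\<sigma> i)) b *\<^sub>R b) = (\<Sum>d\<in>D. f d *\<^sub>R d)" for f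
  proof -
    have "T (\<Sum>b\<in>Basis. f (\<sigma> b) *\<^sub>R b) = (\<Sum>b\<in>Basis. f (\<sigma> b) *\<^sub>R \<sigma> b)"
      by (simp add: T_def)
    also have "\<dots> = (\<Sum>d\<in>D. f d *\<^sub>R d)"
      using \<sigma> by (intro sum.reindex_bij_betw)
    finally show ?thesis by simp
  qed
  have meas: "(\<lambda>f. \<lambda>i\<in>Basis. f (\<sigma> i)) \<in> measurable (\<Pi>\<^sub>M d\<in>D. (lborel::real measure)) (\<Pi>\<^sub>M i\<in>Basis. lborel)"
    using \<sigma> by (intro measurable_restrict measurable_component_singleton) (auto simp: bij_betw_def)
  have "lborel = distr lborel borel T"
    using orth by (simp add: lborel_orthogonal_transformation)
  also have "\<dots> = distr (distr (\<Pi>\<^sub>M b\<in>Basis. lborel) borel (\<lambda>f. \<Sum>b\<in>Basis. f b *\<^sub>R b)) borel T"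
    by (simp flip: lborel_eq)
  also have "\<dots> = distr (\<Pi>\<^sub>M b\<in>Basis. lborel) borel (T \<circ> (\<lambda>f. \<Sum>b\<in>Basis. f b *\<^sub>R b))"
    by (subst distr_distr) (auto simp: T_borel)
  also have "(\<Pi>\<^sub>M b\<in>Basis. lborel) = distr (\<Pi>\<^sub>M d\<in>D. (lborel::real measure)) (\<Pi>\<^sub>M i\<in>Basis. lborel) (\<lambda>f. \<lambda>i\<in>Basis. f (\<sigma> i))"
    using \<sigma> sigma_finite_lborel by (intro PiM_reindex_bij_betw[symmetric]) auto
  also have "distr \<dots> borel (T \<circ> (\<lambda>f. \<Sum>b\<in>Basis. f b *\<^sub>R b))
     = distr (\<Pi>\<^sub>M d\<in>D. lborel) borel ((T \<circ> (\<lambda>f. \<Sum>b\<in>Basis. f b *\<^sub>R b)) \<circ> (\<lambda>f. \<lambda>i\<in>Basis. f (\<sigma> i)))"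
    using meas by (intro distr_distr measurable_comp[OF _ T_borel]) auto
  also have "((T \<circ> (\<lambda>f. \<Sum>b\<in>Basis. f b *\<^sub>R b)) \<circ> (\<lambda>f. \<lambda>i\<in>Basis. f (\<sigma> i))) = (\<lambda>f. \<Sum>d\<in>D. f d *\<^sub>R d)"
    by (auto simp: T_sum simp del: restrict_apply)
  finally show ?thesis .
qed

text \<open>The unit cube of the orthogonal complement turns the volume on a subspace into a full-dimensional
  volume; this makes \<^const>\<open>vol_on\<close> accessible without any further use of its basis.\<close>

proposition vol_on_eq_measure_plus_cube:
  fixes C :: "'a::euclidean_space set"
  assumes C: "pairwise orthogonal C" "\<And>c. c \<in> C \<Longrightarrow> norm c = 1"
    and K: "compact K" "K \<subseteq> (span C)\<^sup>\<bottom>"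
  shows "vol_on ((span C)\<^sup>\<bottom>) K = measure lebesgue (K + (\<Sum>c\<in>C. closed_segment 0 c))"
proof -
  define F where "F = (span C)\<^sup>\<bottom>"
  define B where "B = (SOME B. orthonormal_basis_of F B)"
  have "orthonormal_basis_of F B"
    unfolding B_def F_def
    using orthonormal_basis_of_exists[OF subspace_orthogonal_comp] by (rule someI_ex)
  then have B: "pairwise orthogonal B" "\<And>b. b \<in> B \<Longrightarrow> norm b = 1" "span B = F"
    by (auto simp: orthonormal_basis_of_def)
  have BC: "b \<bullet> c = 0" if "b \<in> B" "c \<in> C" for b c
    using that B(3) span_base[of b B] span_base[of c C]
    by (auto simp: F_def orthogonal_comp_def orthogonal_def inner_commute)
  have disj: "B \<inter> C = {}"
    using BC B(2) norm_eq_1 by fastforce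
  \<comment> \<open>Joined with \<open>C\<close>, the basis \<open>B\<close> used for the volume on
    \<open>F\<close> becomes an orthonormal basis of the whole space, so \<open>lborel\<close>
    splits into a product over \<open>B\<close> and \<open>C\<close>.\<close>
  have onb: "orthonormal_basis_of UNIV (B \<union> C)"
    unfolding orthonormal_basis_of_def
  proof (intro conjI)
    show "pairwise orthogonal (B \<union> C)"
      using B(1) C(1) BC by (auto simp: pairwise_def orthogonal_def) (metis inner_commute)+
    show "\<forall>b\<in>B \<union> C. norm b = 1" using B(2) C(2) by auto
    have "span C + F = UNIV"
      using subspace_sum_orthogonal_comp[of "span C"] by (simp add: F_def)
    then show "span (B \<union> C) = UNIV"
      using B(3) unfolding span_Un set_plus_def by (simp add: set_eq_iff) (metis add.commute)
  qed
  then have "finite (B \<union> C)"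
    by (metis independent_imp_finite norm_zero orthonormal_basis_of_def pairwise_orthogonal_independent zero_neq_one)
  then have fin: "finite B" "finite C" by auto
  define X where "X = (\<lambda>f. \<Sum>b\<in>B. f b *\<^sub>R b) -` K \<inter> space (\<Pi>\<^sub>M b\<in>B. (lborel::real measure))"
  define Q where "Q = K + (\<Sum>c\<in>C. closed_segment 0 c)"
  have "K \<in> sets borel" using K by (simp add: borel_compact)
  have X: "X \<in> sets (\<Pi>\<^sub>M b\<in>B. (lborel::real measure))"
    unfolding X_def using \<open>K \<in> sets borel\<close> by (intro measurable_sets) auto
  have Q: "Q \<in> sets borel"
    using K by (auto simp: Q_def intro!: borel_compact compact_set_plus compact_sum_segments)
  interpret product_sigma_finite "\<lambda>_. lborel :: real measure" ..
  interpret PC: finite_product_sigma_finite "\<lambda>_. lborel :: real measure" C by standard (rule fin)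
  \<comment> \<open>In these coordinates \<open>Q\<close> is a product set: since \<open>K\<close>
    is orthogonal to \<open>C\<close>, the coordinate of a point along \<open>c\<close> is exactly
    its parameter in the segment of \<open>c\<close>.\<close>
  have vimage: "(\<lambda>(f, g). (\<Sum>b\<in>B. f b *\<^sub>R b) + (\<Sum>c\<in>C. g c *\<^sub>R c)) -` Q
        \<inter> space ((\<Pi>\<^sub>M b\<in>B. (lborel::real measure)) \<Otimes>\<^sub>M (\<Pi>\<^sub>M c\<in>C. (lborel::real measure)))
      = X \<times> (\<Pi>\<^sub>E c\<in>C. {0..1})" (is "?L = ?R")
  proof -
    have "(\<Sum>b\<in>B. f b *\<^sub>R b) + (\<Sum>c\<in>C. g c *\<^sub>R c) \<in> Q
        \<longleftrightarrow> (\<Sum>b\<in>B. f b *\<^sub>R b) \<in> K \<and> (\<forall>c\<in>C. g c \<in> {0..1})" for f g :: "'a \<Rightarrow> real"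
    proof
      assume "(\<Sum>b\<in>B. f b *\<^sub>R b) + (\<Sum>c\<in>C. g c *\<^sub>R c) \<in> Q"
      then obtain x r where x: "x \<in> K" "\<forall>c\<in>C. r c \<in> {0..1}"
        and eq: "(\<Sum>b\<in>B. f b *\<^sub>R b) + (\<Sum>c\<in>C. g c *\<^sub>R c) = x + (\<Sum>c\<in>C. r c *\<^sub>R c)"
        unfolding Q_def sum_segments_eq[OF fin(2)] set_plus_def by blast
      have "r c = g c" if "c \<in> C" for c
      proof -
        have "x \<bullet> c = 0"
          using x(1) K(2) span_base[OF that] by (auto simp: orthogonal_comp_def orthogonal_def inner_commute)
        moreover have "(\<Sum>b\<in>B. f b *\<^sub>R b) \<bullet> c = 0"
          using BC that by (simp add: inner_sum_left)
        moreover have "(\<Sum>c\<in>C. h c *\<^sub>R c) \<bullet> c = h c" for h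
        proof -
          have "(\<Sum>d\<in>C. h d *\<^sub>R d) \<bullet> c = (\<Sum>d\<in>C. if d = c then h c else 0)"
            using that C norm_eq_1[of c] unfolding inner_sum_left
            by (intro sum.cong) (auto simp: pairwise_def orthogonal_def)
          with that fin show ?thesis by simp
        qed
        ultimately show ?thesis
          using arg_cong[OF eq, of "\<lambda>y. y \<bullet> c"] by (simp add: inner_add_left)
      qed
      with eq x show "(\<Sum>b\<in>B. f b *\<^sub>R b) \<in> K \<and> (\<forall>c\<in>C. g c \<in> {0..1})"
        by simp
    next
      assume "(\<Sum>b\<in>B. f b *\<^sub>R b) \<in> K \<and> (\<forall>c\<in>C. g c \<in> {0..1})"
      then show "(\<Sum>b\<in>B. f b *\<^sub>R b) + (\<Sum>c\<in>C. g c *\<^sub>R c) \<in> Q"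
        unfolding Q_def sum_segments_eq[OF fin(2)] by blast
    qed
    then show ?thesis
      unfolding X_def by (auto simp: space_pair_measure space_PiM PiE_iff)
  qed
  have "emeasure lborel Q = emeasure (distr (\<Pi>\<^sub>M b\<in>B \<union> C. lborel) borel (\<lambda>f. \<Sum>b\<in>B \<union> C. f b *\<^sub>R b)) Q"
    by (simp flip: lborel_eq_orthonormal[OF onb])
  also have "(\<Pi>\<^sub>M b\<in>B \<union> C. lborel) = distr ((\<Pi>\<^sub>M b\<in>B. (lborel::real measure)) \<Otimes>\<^sub>M (\<Pi>\<^sub>M c\<in>C. lborel)) (\<Pi>\<^sub>M b\<in>B \<union> C. lborel) (merge B C)"
    by (rule distr_merge[OF disj fin, symmetric])
  also have "distr \<dots> borel (\<lambda>f. \<Sum>b\<in>B \<union> C. f b *\<^sub>R b) = distr ((\<Pi>\<^sub>M b\<in>B. lborel) \<Otimes>\<^sub>M (\<Pi>\<^sub>M c\<in>C. lborel)) borel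
     ((\<lambda>f. \<Sum>b\<in>B \<union> C. f b *\<^sub>R b) \<circ> merge B C)"
    by (intro distr_distr) auto
  also have "(\<lambda>f. \<Sum>b\<in>B \<union> C. f b *\<^sub>R b) \<circ> merge B C = (\<lambda>(f, g). (\<Sum>b\<in>B. f b *\<^sub>R b) + (\<Sum>c\<in>C. g c *\<^sub>R c))"
    using disj fin by (auto simp: fun_eq_iff sum.union_disjoint intro!: arg_cong2[of _ _ _ _ "(+)"] sum.cong)
  also have "emeasure (distr ((\<Pi>\<^sub>M b\<in>B. (lborel::real measure)) \<Otimes>\<^sub>M (\<Pi>\<^sub>M c\<in>C. (lborel::real measure))) borel \<dots>) Q
      = emeasure ((\<Pi>\<^sub>M b\<in>B. (lborel::real measure)) \<Otimes>\<^sub>M (\<Pi>\<^sub>M c\<in>C. (lborel::real measure))) (X \<times> (\<Pi>\<^sub>E c\<in>C. {0..1}))"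
  proof (subst emeasure_distr[OF _ Q], goal_cases)
    case 1
    show ?case
      unfolding split_beta' by (intro borel_measurable_add measurable_compose[OF measurable_fst borel_measurable_linear_combination]
          measurable_compose[OF measurable_snd borel_measurable_linear_combination]) auto
  qed (simp add: vimage)
  also have "\<dots> = emeasure (\<Pi>\<^sub>M b\<in>B. (lborel::real measure)) X * emeasure (\<Pi>\<^sub>M c\<in>C. (lborel::real measure)) (\<Pi>\<^sub>E c\<in>C. {0..1})"
    using X fin by (intro PC.emeasure_pair_measure_Times) (auto intro!: sets_PiM_I_finite)
  \<comment> \<open>The unit cube in the \<open>C\<close> coordinates has measure 1, so only the
    measure of \<open>X\<close>, the volume of \<open>K\<close> within \<open>F\<close>,
    remains.\<close>
  also have "emeasure (\<Pi>\<^sub>M c\<in>C. (lborel::real measure)) (\<Pi>\<^sub>E c\<in>C. {0..1}) = 1"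
    using fin by (subst emeasure_PiM) auto
  also have "emeasure (\<Pi>\<^sub>M b\<in>B. (lborel::real measure)) X = emeasure (lborel_on F) K"
    unfolding X_def lborel_on_def Let_def B_def[symmetric]
    using \<open>K \<in> sets borel\<close> by (subst emeasure_distr) auto
  finally have "emeasure lborel Q = emeasure (lborel_on F) K" by simp
  then show ?thesis
    using Q by (simp add: vol_on_def measure_def F_def Q_def)
qed

section \<open>Volume of zonotopes\<close>

lemma measure_scaleR_image:
  fixes S :: "'a::euclidean_space set"
  assumes "S \<in> lmeasurable" "r \<ge> 0"
  shows "measure lebesgue ((*\<^sub>R) r ` S) = r ^ DIM('a) * measure lebesgue S"
proof -
  have cbox: "measure lebesgue ((*\<^sub>R) r ` cbox a b) = r ^ DIM('a) * measure lebesgue (cbox a b)" for a b :: 'a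
  proof -
    have "(*\<^sub>R) r ` cbox a b \<in> lmeasurable"
      by (intro lmeasurable_compact compact_scaling) auto
    moreover have "(*\<^sub>R) r ` cbox a b \<in> sets borel"
      by (intro borel_compact compact_scaling) auto
    ultimately show ?thesis
      using assms(2) content_image_affinity_cbox[of r 0 a b] by (simp add: measure_completion)
  qed
  show ?thesis
    using measure_linear_sufficient[OF linear_scaleR assms(1) cbox] by simp
qed

text \<open>Induction on \<open>J\<close> for all \<open>K\<close> at once: the volume is affine in
  \<open>t j\<close>, and its values at \<open>t j = 0\<close> and \<open>t j = 1\<close> come from
  the induction hypothesis for \<open>K\<close> and for \<open>K + seg\<close>. The coefficients are
  fixed before \<open>t\<close>, as comparing them later requires.\<close>

lemma zonotope_multi_affine:
  fixes z :: "'i \<Rightarrow> 'a::euclidean_space"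
  assumes "finite J" "compact K" "convex K"
  obtains m where "\<And>t. (\<And>j. j \<in> J \<Longrightarrow> t j \<ge> 0) \<Longrightarrow>
      measure lebesgue (K + (\<Sum>j\<in>J. closed_segment 0 (t j *\<^sub>R z j))) = (\<Sum>S\<in>Pow J. (\<Prod>j\<in>S. t j) * m S)"
  using assms
proof (induction J arbitrary: K thesis rule: finite_induct)
  case empty
  show ?case by (rule empty(1)[of "\<lambda>_. measure lebesgue K"]) simp
next
  case (insert j J)
  define seg where "seg = closed_segment 0 (z j)"
  have seg: "compact (K + seg)" "convex (K + seg)"
    using insert.prems by (auto simp: seg_def compact_set_plus convex_set_plus)
  obtain m0 where m0: "\<And>t. (\<And>j. j \<in> J \<Longrightarrow> t j \<ge> 0) \<Longrightarrow>
      measure lebesgue (K + (\<Sum>j\<in>J. closed_segment 0 (t j *\<^sub>R z j))) = (\<Sum>S\<in>Pow J. (\<Prod>j\<in>S. t j) * m0 S)"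
    using insert.IH[of K] insert.prems by blast
  obtain m1 where m1: "\<And>t. (\<And>j. j \<in> J \<Longrightarrow> t j \<ge> 0) \<Longrightarrow>
      measure lebesgue (K + seg + (\<Sum>j\<in>J. closed_segment 0 (t j *\<^sub>R z j))) = (\<Sum>S\<in>Pow J. (\<Prod>j\<in>S. t j) * m1 S)"
    using insert.IH[of "K + seg"] seg by blast
  \<comment> \<open>For sets without \<open>j\<close> this is the value at \<open>t j = 0\<close>;
    for sets with \<open>j\<close> it is the slope, the difference between the values at 1 and
    0.\<close>
  define m where "m S = (if j \<in> S then m1 (S - {j}) - m0 (S - {j}) else m0 S)" for S
  show ?case
  proof (rule insert.prems(1)[of m])
    fix t assume t: "\<And>i. i \<in> insert j J \<Longrightarrow> (t i :: real) \<ge> 0"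
    define L where "L = K + (\<Sum>j\<in>J. closed_segment 0 (t j *\<^sub>R z j))"
    have L: "compact L" "convex L"
      using insert.prems by (auto simp: L_def compact_set_plus convex_set_plus compact_sum_segments convex_sum_segments)
    have J: "measure lebesgue L = (\<Sum>S\<in>Pow J. (\<Prod>j\<in>S. t j) * m0 S)"
      unfolding L_def using t by (intro m0) auto
    have Lj: "measure lebesgue (L + seg) = (\<Sum>S\<in>Pow J. (\<Prod>j\<in>S. t j) * m1 S)"
      using m1[of t] t by (simp add: L_def ac_simps)
    have "K + (\<Sum>i\<in>insert j J. closed_segment 0 (t i *\<^sub>R z i)) = L + closed_segment 0 (t j *\<^sub>R z j)"
      using insert.hyps by (simp add: L_def ac_simps)
    then have "measure lebesgue (K + (\<Sum>i\<in>insert j J. closed_segment 0 (t i *\<^sub>R z i)))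
        = (\<Sum>S\<in>Pow J. (\<Prod>j\<in>S. t j) * m0 S)
          + t j * ((\<Sum>S\<in>Pow J. (\<Prod>j\<in>S. t j) * m1 S) - (\<Sum>S\<in>Pow J. (\<Prod>j\<in>S. t j) * m0 S))"
      using measure_plus_segment_affine[OF L, of "t j" "z j"] t J Lj by (simp add: seg_def)
    also have "\<dots> = (\<Sum>S\<in>Pow J. (\<Prod>i\<in>S. t i) * m S) + (\<Sum>S\<in>insert j ` Pow J. (\<Prod>i\<in>S. t i) * m S)"
    proof -
      have inj: "inj_on (insert j) (Pow J)"
        using insert.hyps by (auto simp: inj_on_def)
      have "(\<Sum>S\<in>insert j ` Pow J. (\<Prod>i\<in>S. t i) * m S) = (\<Sum>S\<in>Pow J. t j * ((\<Prod>i\<in>S. t i) * (m1 S - m0 S)))"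
        unfolding sum.reindex[OF inj] o_def
      proof (intro sum.cong refl)
        fix S assume "S \<in> Pow J"
        then have "finite S" "j \<notin> S" using insert.hyps finite_subset by auto
        then show "(\<Prod>i\<in>insert j S. t i) * m (insert j S) = t j * ((\<Prod>i\<in>S. t i) * (m1 S - m0 S))"
          by (simp add: m_def)
      qed
      moreover have "(\<Sum>S\<in>Pow J. (\<Prod>i\<in>S. t i) * m S) = (\<Sum>S\<in>Pow J. (\<Prod>i\<in>S. t i) * m0 S)"
        using insert.hyps by (intro sum.cong) (auto simp: m_def)
      ultimately show ?thesis
        by (simp add: sum_distrib_left sum_subtractf algebra_simps)
    qed
    also have "\<dots> = (\<Sum>S\<in>Pow (insert j J). (\<Prod>i\<in>S. t i) * m S)"
      using insert.hyps unfolding Pow_insert by (subst sum.union_disjoint) auto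
    finally show "measure lebesgue (K + (\<Sum>i\<in>insert j J. closed_segment 0 (t i *\<^sub>R z i)))
        = (\<Sum>S\<in>Pow (insert j J). (\<Prod>i\<in>S. t i) * m S)" .
  qed
qed

text \<open>Only the degree \<open>DIM('a)\<close> part of the multi-affine polynomial survives, because the
  volume is homogeneous of that degree.\<close>

theorem zonotope_volume:
  fixes z :: "'i \<Rightarrow> 'a::euclidean_space"
  assumes "finite J"
  shows "measure lebesgue (\<Sum>j\<in>J. closed_segment 0 (z j))
       = (\<Sum>S | S \<subseteq> J \<and> card S = DIM('a). measure lebesgue (\<Sum>j\<in>S. closed_segment 0 (z j)))"
proof -
  define f where "f T = measure lebesgue (\<Sum>j\<in>T. closed_segment 0 (z j))" for T
  obtain m where m: "\<And>t. (\<And>j. j \<in> J \<Longrightarrow> t j \<ge> 0) \<Longrightarrow>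
      measure lebesgue ({0} + (\<Sum>j\<in>J. closed_segment 0 (t j *\<^sub>R z j))) = (\<Sum>S\<in>Pow J. (\<Prod>j\<in>S. t j) * m S)"
    using zonotope_multi_affine[OF assms, of "{0}" z] by auto
  have scaled: "r ^ DIM('a) * f T = (\<Sum>S\<in>Pow T. r ^ card S * m S)" if "T \<subseteq> J" "r \<ge> 0" for r T
  proof -
    \<comment> \<open>Length 0 switches off the segments outside \<open>T\<close>. Thus one
      coefficient function \<open>m\<close> serves all subfamilies and all scaling factors
      \<open>r\<close>.\<close>
    define t where "t j = (if j \<in> T then r else 0)" for j
    have "finite T" using that assms finite_subset by blast
    have "(\<Sum>j\<in>J. closed_segment 0 (t j *\<^sub>R z j)) = (\<Sum>j\<in>T. closed_segment 0 (r *\<^sub>R z j))"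
      using that assms by (intro sum.mono_neutral_cong_right) (auto simp: t_def)
    also have "\<dots> = (*\<^sub>R) r ` (\<Sum>j\<in>T. closed_segment 0 (z j))"
    proof -
      have "r *\<^sub>R (\<Sum>j\<in>T. q j *\<^sub>R z j) = (\<Sum>j\<in>T. q j *\<^sub>R r *\<^sub>R z j)" for q
        by (simp add: scaleR_sum_right mult.commute)
      then show ?thesis
        unfolding sum_segments_eq[OF \<open>finite T\<close>] by (auto simp: image_iff) metis+
    qed
    finally have "r ^ DIM('a) * f T = measure lebesgue ({0} + (\<Sum>j\<in>J. closed_segment 0 (t j *\<^sub>R z j)))"
      using \<open>r \<ge> 0\<close> by (simp add: f_def measure_scaleR_image lmeasurable_compact compact_sum_segments)
    also have "\<dots> = (\<Sum>S\<in>Pow J. (\<Prod>j\<in>S. t j) * m S)"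
      using \<open>r \<ge> 0\<close> by (intro m) (auto simp: t_def)
    also have "\<dots> = (\<Sum>S\<in>Pow T. r ^ card S * m S)"
    proof (intro sum.mono_neutral_cong_right ballI)
      fix S assume "S \<in> Pow J - Pow T"
      then obtain j where "j \<in> S" "j \<notin> T" "finite S" using assms finite_subset by blast
      then show "(\<Prod>j\<in>S. t j) * m S = 0" by (auto simp: t_def intro!: prod_zero)
    next
      fix S assume "S \<in> Pow T"
      then have "(\<Prod>j\<in>S. t j) = (\<Prod>j\<in>S. r)" by (intro prod.cong) (auto simp: t_def)
      then show "(\<Prod>j\<in>S. t j) * m S = r ^ card S * m S" by simp
    qed (use that assms in auto)
    finally show ?thesis .
  qed
  have homogeneous: "f T = (\<Sum>S | S \<subseteq> T \<and> card S = DIM('a). m S)" if "T \<subseteq> J" for T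
  proof -
    have "finite T" using that assms finite_subset by blast
    \<comment> \<open>Both sides of \<open>scaled\<close> are polynomials in \<open>r\<close> that
      agree on the half line, so their coefficients of degree \<open>DIM('a)\<close> agree.\<close>
    define p where "p = monom (f T) DIM('a) - (\<Sum>S\<in>Pow T. monom (m S) (card S))"
    have "{0..} \<subseteq> {r. poly p r = 0}"
      using scaled[OF that] by (auto simp: p_def poly_monom poly_sum mult.commute)
    moreover have "infinite {0::real..}" by (simp add: infinite_Ici)
    ultimately have "p = 0"
      using poly_roots_finite finite_subset by blast
    then have "coeff p DIM('a) = 0" by simp
    then have "f T = (\<Sum>S\<in>Pow T. if card S = DIM('a) then m S else 0)"
      by (simp add: p_def coeff_sum coeff_monom if_distrib cong: if_cong)
    also have "\<dots> = (\<Sum>S\<in>Pow T \<inter> {S. card S = DIM('a)}. m S)"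
      using \<open>finite T\<close> by (simp add: sum.inter_restrict)
    also have "Pow T \<inter> {S. card S = DIM('a)} = {S. S \<subseteq> T \<and> card S = DIM('a)}" by auto
    finally show ?thesis .
  qed
  \<comment> \<open>For a set of exactly \<open>DIM('a)\<close> segments the sum in
    \<open>homogeneous\<close> has a single term, which identifies the coefficient as a
    volume.\<close>
  have "f S = m S" if "S \<subseteq> J" "card S = DIM('a)" for S
  proof -
    have "finite S" using that assms finite_subset by blast
    then have "{S'. S' \<subseteq> S \<and> card S' = DIM('a)} = {S}"
      using that by (auto dest: card_subset_eq)
    with homogeneous[OF that(1)] show ?thesis by simp
  qed
  then show ?thesis
    using homogeneous[of J] by (simp add: f_def)
qed

section \<open>Multilinearity of the volume of a parallelotope\<close>

lemma linear_image_set_plus: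
  assumes "linear f"
  shows "f ` (A + B) = f ` A + f ` B"
  using assms by (force simp: set_plus_def linear_add)

lemma linear_image_sum_segments:
  assumes "linear f"
  shows "f ` (\<Sum>i\<in>I. closed_segment 0 (z i)) = (\<Sum>i\<in>I. closed_segment 0 (f (z i)))"
proof -
  have "closed_segment 0 (f y) = f ` closed_segment 0 y" for y
    using closed_segment_linear_image[OF assms, of 0 y] by (simp add: linear_0 assms)
  then show ?thesis
    by (induction I rule: infinite_finite_induct) (simp_all add: linear_image_set_plus linear_0 assms)
qed

lemma linear_diff_inner_scaleR: "linear (\<lambda>x :: 'a::real_inner. x - (x \<bullet> e) *\<^sub>R e)"
  by (auto intro!: linearI simp: algebra_simps)

text \<open>When the index set has \<open>DIM('a)\<close> elements this is the absolute value of the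
  determinant of the family. Working with families keeps equal vectors as separate segments and lets
  \<open>fun_upd\<close> exchange a single edge.\<close>

definition zonotope_vol :: "'i set \<Rightarrow> ('i \<Rightarrow> 'a::euclidean_space) \<Rightarrow> real" where
  "zonotope_vol I z = measure lebesgue (\<Sum>i\<in>I. closed_segment 0 (z i))"

text \<open>With fewer than \<open>DIM('a)\<close> segments the sum in
  \<open>zonotope_volume\<close> is empty.\<close>

lemma zonotope_vol_degenerate:
  fixes z :: "'i \<Rightarrow> 'a::euclidean_space"
  assumes "finite I" "card I < DIM('a)"
  shows "zonotope_vol I z = 0"
proof -
  have *: "card S < DIM('a)" if "S \<subseteq> I" for S
    using card_mono[OF assms(1) that] assms(2) by simp
  have "{S. S \<subseteq> I \<and> card S = DIM('a)} = {}"
    by (auto dest!: *)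
  then show ?thesis
    unfolding zonotope_vol_def by (subst zonotope_volume[OF assms(1)]) (simp only: sum.empty)
qed

context
  fixes I :: "'i set" and z :: "'i \<Rightarrow> 'a::euclidean_space"
  assumes fin: "finite I" and card_le: "card I \<le> DIM('a)"
begin

lemma zonotope_vol_remove_eq_0: "i \<in> I \<Longrightarrow> measure lebesgue (\<Sum>k\<in>I - {i}. closed_segment 0 (z' k)) = 0"
  for z' :: "'i \<Rightarrow> 'a"
  using fin card_le zonotope_vol_degenerate[of "I - {i}" z'] card_Diff1_less[of I i]
  by (simp add: zonotope_vol_def)

text \<open>The remaining edges span a null set, so the affine law is proportional to the edge
  length. A negative factor gives a translate of the segment with factor
  \<open>\<bar>c\<bar>\<close>.\<close>

lemma zonotope_vol_scale:
  assumes "i \<in> I"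
  shows "zonotope_vol I (z(i := c *\<^sub>R z i)) = \<bar>c\<bar> * zonotope_vol I z"
proof -
  define K where "K = (\<Sum>k\<in>I - {i}. closed_segment 0 (z k))"
  have K: "compact K" "convex K" by (auto simp: K_def compact_sum_segments convex_sum_segments)
  have K0: "measure lebesgue K = 0"
    unfolding K_def using assms by (rule zonotope_vol_remove_eq_0)
  have eq: "(\<Sum>k\<in>I. closed_segment 0 ((z(i := y)) k)) = K + closed_segment 0 y" for y
    using fin assms unfolding K_def
    by (subst sum.remove[of I i]) (auto simp: add.commute intro!: arg_cong2[of _ _ _ _ "(+)"] sum.cong)
  have seg: "measure lebesgue (K + closed_segment 0 (\<bar>c\<bar> *\<^sub>R z i)) = \<bar>c\<bar> * zonotope_vol I z"
    using measure_plus_segment_affine[OF K, of "\<bar>c\<bar>" "z i"] eq[of "z i"] K0 by (simp add: zonotope_vol_def)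
  show ?thesis
  proof (cases "c \<ge> 0")
    case True
    then show ?thesis using seg eq[of "c *\<^sub>R z i"] by (simp add: zonotope_vol_def)
  next
    case False
    have "closed_segment 0 (c *\<^sub>R z i) = (+) (c *\<^sub>R z i) ` closed_segment 0 (- c *\<^sub>R z i)"
      using closed_segment_translation[of "c *\<^sub>R z i" 0 "- c *\<^sub>R z i"] by (simp add: closed_segment_commute)
    then have "K + closed_segment 0 (c *\<^sub>R z i) = (+) (c *\<^sub>R z i) ` (K + closed_segment 0 (\<bar>c\<bar> *\<^sub>R z i))"
      using False by (force simp: set_plus_def image_iff add.left_commute)
    then show ?thesis
      using seg eq[of "c *\<^sub>R z i"] by (simp add: zonotope_vol_def measure_translation)
  qed
qed

text \<open>By \<open>measure_plus_segment_orthogonal\<close> the volume depends on the other edges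
  only through their projections along \<open>z j\<close>, and this projection kills the added
  multiple of \<open>z j\<close>.\<close>

lemma zonotope_vol_shear:
  assumes "i \<in> I" "j \<in> I" "i \<noteq> j"
  shows "zonotope_vol I (z(i := z i + c *\<^sub>R z j)) = zonotope_vol I z"
proof (cases "z j = 0")
  case False
  define e where "e = z j /\<^sub>R norm (z j)"
  define f where "f x = x - (x \<bullet> e) *\<^sub>R e" for x
  have e: "norm e = 1" "z j = norm (z j) *\<^sub>R e" using False by (auto simp: e_def)
  have f: "linear f" using linear_diff_inner_scaleR[of e] by (simp add: f_def[abs_def])
  have "e \<bullet> e = 1" using e(1) by (simp add: norm_eq_1)
  then have "f (z j) = 0" by (subst e(2)) (simp add: f_def)
  have vol: "zonotope_vol I z' = norm (z j) * measure lebesgue ((\<Sum>k\<in>I - {j}. closed_segment 0 (f (z' k))) + closed_segment 0 e)"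
    if "z' j = z j" for z'
  proof -
    define K where "K = (\<Sum>k\<in>I - {j}. closed_segment 0 (z' k))"
    have K: "compact K" "convex K" by (auto simp: K_def compact_sum_segments convex_sum_segments)
    have "(\<Sum>k\<in>I. closed_segment 0 (z' k)) = K + closed_segment 0 (norm (z j) *\<^sub>R e)"
      using fin assms that unfolding K_def e(2)[symmetric]
      by (subst sum.remove[of I j]) (auto simp: add.commute)
    moreover have "measure lebesgue K = 0"
      unfolding K_def using assms(2) by (rule zonotope_vol_remove_eq_0)
    ultimately show ?thesis
      using measure_plus_segment_orthogonal[OF K e(1), of "norm (z j)"] linear_image_sum_segments[OF f, of z' "I - {j}"]
      by (simp add: zonotope_vol_def K_def f_def)
  qed
  have "f (z i + c *\<^sub>R z j) = f (z i)"
    using f \<open>f (z j) = 0\<close> by (simp add: linear_add linear_scale)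
  then have fz: "f ((z(i := z i + c *\<^sub>R z j)) k) = f (z k)" for k
    by simp
  have "(z(i := z i + c *\<^sub>R z j)) j = z j" using assms by simp
  then show ?thesis
    using vol[of z] vol[of "z(i := z i + c *\<^sub>R z j)"] unfolding fz by metis
qed simp

end

context
  fixes I :: "'i set" and w :: "'i \<Rightarrow> 'a::euclidean_space"
  assumes fin: "finite I" and card_le: "card I \<le> DIM('a)"
begin

lemma zonotope_vol_shear_sum:
  fixes z :: "'i \<Rightarrow> 'a"
  assumes "i \<in> I" "J \<subseteq> I - {i}"
  shows "zonotope_vol I (z(i := z i + (\<Sum>k\<in>J. c k *\<^sub>R z k))) = zonotope_vol I z"
proof -
  have "finite J" using assms fin finite_subset by blast
  then show ?thesis
    using assms(2)
  proof (induction J)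
    case (insert j J)
    define z' where "z' = z(i := z i + (\<Sum>k\<in>J. c k *\<^sub>R z k))"
    have "z(i := z i + (\<Sum>k\<in>insert j J. c k *\<^sub>R z k)) = z'(i := z' i + c j *\<^sub>R z' j)"
      using insert by (auto simp: z'_def fun_eq_iff)
    moreover have "zonotope_vol I (z'(i := z' i + c j *\<^sub>R z' j)) = zonotope_vol I z'"
      using insert.prems by (intro zonotope_vol_shear[OF fin card_le assms(1)]) auto
    moreover have "zonotope_vol I z' = zonotope_vol I z"
      using insert.IH insert.prems unfolding z'_def by blast
    ultimately show ?case by metis
  qed simp
qed

text \<open>Cramer's rule in absolute value: scale \<open>w i\<close> by \<open>x i\<close>, then
  add the other terms by shears.\<close>

lemma zonotope_vol_replace:
  assumes "i \<in> I"
  shows "zonotope_vol I (w(i := \<Sum>k\<in>I. x k *\<^sub>R w k)) = \<bar>x i\<bar> * zonotope_vol I w"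
proof -
  define z where "z = w(i := x i *\<^sub>R w i)"
  have "w(i := \<Sum>k\<in>I. x k *\<^sub>R w k) = z(i := z i + (\<Sum>k\<in>I - {i}. x k *\<^sub>R z k))"
    using fin assms by (auto simp: z_def fun_eq_iff sum.remove[of I i])
  then show ?thesis
    using zonotope_vol_shear_sum[OF assms order_refl, of z x] zonotope_vol_scale[OF fin card_le assms, of w "x i"]
    by (simp add: z_def)
qed

lemma sum_segments_upd2:
  assumes "i \<in> I" "j \<in> I" "i \<noteq> j"
  shows "(\<Sum>k\<in>I. closed_segment 0 ((w(i := p, j := q)) k))
      = closed_segment 0 p + (closed_segment 0 q + (\<Sum>k\<in>I - {i} - {j}. closed_segment 0 (w k)))"
  using fin assms
  by (subst sum.remove[of I i], simp, simp, subst sum.remove[of "I - {i}" j])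
    (auto intro!: arg_cong2[of _ _ _ _ "(+)"] sum.cong)

lemma zonotope_vol_swap:
  assumes "i \<in> I" "j \<in> I" "i \<noteq> j"
  shows "zonotope_vol I (w(i := p, j := q)) = zonotope_vol I (w(i := q, j := p))"
  unfolding zonotope_vol_def sum_segments_upd2[OF assms] by (simp only: add.left_commute)

text \<open>The analogue of Cramer's rule with a 2 by 2 minor. Shears remove all components outside
  \<open>w i\<close> and \<open>w j\<close>; then Gaussian elimination with pivot \<open>x i\<close>
  finishes. If only \<open>x j\<close> is nonzero the two slots are exchanged, and if both vanish so
  do both sides.\<close>

lemma zonotope_vol_replace2:
  assumes "i \<in> I" "j \<in> I" "i \<noteq> j"
  shows "zonotope_vol I (w(i := \<Sum>k\<in>I. x k *\<^sub>R w k, j := \<Sum>k\<in>I. y k *\<^sub>R w k))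
       = \<bar>x i * y j - x j * y i\<bar> * zonotope_vol I w"
proof -
  have reduce: "zonotope_vol I (w(i := \<Sum>k\<in>I. x k *\<^sub>R w k, j := \<Sum>k\<in>I. y k *\<^sub>R w k))
      = zonotope_vol I (w(i := x i *\<^sub>R w i + x j *\<^sub>R w j, j := y i *\<^sub>R w i + y j *\<^sub>R w j))"
  proof -
    define J where "J = I - {i, j}"
    have sum_I: "(\<Sum>k\<in>I. c k *\<^sub>R w k) = c i *\<^sub>R w i + c j *\<^sub>R w j + (\<Sum>k\<in>J. c k *\<^sub>R w k)" for c
    proof -
      have "I = insert i (insert j J)" "finite J" "i \<notin> J" "j \<notin> J"
        using fin assms by (auto simp: J_def)
      with assms(3) show ?thesis by (simp add: add.assoc)
    qed
    define z where "z = w(i := x i *\<^sub>R w i + x j *\<^sub>R w j, j := y i *\<^sub>R w i + y j *\<^sub>R w j)"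
    define z' where "z' = z(i := z i + (\<Sum>k\<in>J. x k *\<^sub>R z k))"
    have zJ: "z k = w k" "z' k = w k" if "k \<in> J" for k using that by (auto simp: J_def z_def z'_def)
    have "(\<Sum>k\<in>J. c k *\<^sub>R z k) = (\<Sum>k\<in>J. c k *\<^sub>R w k)"
         "(\<Sum>k\<in>J. c k *\<^sub>R z' k) = (\<Sum>k\<in>J. c k *\<^sub>R w k)" for c
      by (simp_all add: zJ)
    moreover from this(1) have "z' j = y i *\<^sub>R w i + y j *\<^sub>R w j"
      "z' = w(i := \<Sum>k\<in>I. x k *\<^sub>R w k, j := y i *\<^sub>R w i + y j *\<^sub>R w j)"
      using assms(3) unfolding z'_def sum_I by (auto simp: z_def fun_eq_iff)
    ultimately have "w(i := \<Sum>k\<in>I. x k *\<^sub>R w k, j := \<Sum>k\<in>I. y k *\<^sub>R w k)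
        = z'(j := z' j + (\<Sum>k\<in>J. y k *\<^sub>R z' k))"
      using sum_I[of y] by simp
    then show ?thesis
      using zonotope_vol_shear_sum[OF assms(2), of J z' y] zonotope_vol_shear_sum[OF assms(1), of J z x]
      by (simp add: z'_def J_def z_def subset_eq)
  qed
  have main: "zonotope_vol I (w(i := x i *\<^sub>R w i + x j *\<^sub>R w j, j := y i *\<^sub>R w i + y j *\<^sub>R w j))
       = \<bar>x i * y j - x j * y i\<bar> * zonotope_vol I w" if "i \<in> I" "j \<in> I" "i \<noteq> j" "x i \<noteq> 0" for i j x y
  proof -
    \<comment> \<open>The coefficient of \<open>w j\<close> left in the second vector after its
      \<open>w i\<close> component is eliminated with the first; \<open>x i * d\<close> is the
      minor.\<close>
    define d where "d = y j - x j * y i / x i"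
    define z where "z = w(i := x i *\<^sub>R w i)"
    define z' where "z' = w(i := x i *\<^sub>R w i + x j *\<^sub>R w j)"
    define z'' where "z'' = z'(j := y i *\<^sub>R w i + y j *\<^sub>R w j)"
    have "zonotope_vol I z = \<bar>x i\<bar> * zonotope_vol I w"
      unfolding z_def by (rule zonotope_vol_scale[OF fin card_le that(1)])
    moreover have "z' = z(i := z i + x j *\<^sub>R z j)"
      using that by (auto simp: z'_def z_def)
    then have "zonotope_vol I z' = zonotope_vol I z"
      using zonotope_vol_shear[OF fin card_le that(1-3), of z "x j"] by simp
    moreover have "z''(j := z'' j + (- y i / x i) *\<^sub>R z'' i) = z'(j := d *\<^sub>R z' j)"
    proof -
      have "y i *\<^sub>R w i + y j *\<^sub>R w j + (- y i / x i) *\<^sub>R (x i *\<^sub>R w i + x j *\<^sub>R w j) = d *\<^sub>R w j"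
        using that(4) by (simp add: d_def algebra_simps)
      then show ?thesis using that(3) by (simp add: z''_def z'_def fun_eq_iff)
    qed
    then have "zonotope_vol I z'' = \<bar>d\<bar> * zonotope_vol I z'"
      using zonotope_vol_shear[OF fin card_le that(2,1), of z'' "- y i / x i"] that(3)
        zonotope_vol_scale[OF fin card_le that(2), of z' d] by simp
    moreover have "\<bar>d\<bar> * \<bar>x i\<bar> = \<bar>x i * y j - x j * y i\<bar>"
      using that(4) unfolding d_def abs_mult[symmetric] by (simp add: algebra_simps)
    ultimately show ?thesis
      by (simp add: z''_def z'_def mult.assoc flip: \<open>\<bar>d\<bar> * \<bar>x i\<bar> = _\<close>)
  qed
  consider "x i \<noteq> 0" | "x i = 0" "x j \<noteq> 0" | "x i = 0" "x j = 0" by blast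
  then show ?thesis
  proof cases
    case 1
    then show ?thesis unfolding reduce by (rule main[OF assms])
  next
    case 2
    have "zonotope_vol I (w(i := x i *\<^sub>R w i + x j *\<^sub>R w j, j := y i *\<^sub>R w i + y j *\<^sub>R w j))
        = zonotope_vol I (w(j := x j *\<^sub>R w j + x i *\<^sub>R w i, i := y j *\<^sub>R w j + y i *\<^sub>R w i))"
      unfolding add.commute[of "x j *\<^sub>R w j"] add.commute[of "y j *\<^sub>R w j"]
      by (subst fun_upd_twist[OF assms(3)[symmetric]]) (rule zonotope_vol_swap[OF assms])
    also have "\<dots> = \<bar>x j * y i - x i * y j\<bar> * zonotope_vol I w"
      using assms 2 by (intro main) auto
    finally show ?thesis using reduce by (simp add: abs_minus_commute)
  next
    case 3
    define z where "z = w(j := y i *\<^sub>R w i + y j *\<^sub>R w j)"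
    have "w(i := x i *\<^sub>R w i + x j *\<^sub>R w j, j := y i *\<^sub>R w i + y j *\<^sub>R w j) = z(i := 0 *\<^sub>R z i)"
      using assms 3 by (auto simp: z_def)
    with 3 show ?thesis
      using reduce zonotope_vol_scale[OF fin card_le assms(1), of z 0] by simp
  qed
qed

end

section \<open>Volumes of projections\<close>

lemma orth_proj_eqI:
  assumes "subspace E" "y \<in> E" "x - y \<in> E\<^sup>\<bottom>"
  shows "orth_proj E x = y"
  unfolding orth_proj_def
  using orth_proj_unique_existence[OF assms(1), of x] assms(2,3) by (intro the1_equality) auto

lemma orthogonal_comp_span_iff: "x \<in> (span S)\<^sup>\<bottom> \<longleftrightarrow> (\<forall>s\<in>S. s \<bullet> x = 0)"
proof
  assume "\<forall>s\<in>S. s \<bullet> x = 0"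
  then have "S \<subseteq> {y. y \<bullet> x = 0}" by blast
  then have "span S \<subseteq> {y. y \<bullet> x = 0}"
    by (rule span_minimal) (auto simp: subspace_def inner_add_left)
  then show "x \<in> (span S)\<^sup>\<bottom>" by (auto simp: orthogonal_comp_def orthogonal_def)
qed (auto simp: orthogonal_comp_def orthogonal_def span_base)

lemma orthogonal_comp_singleton: "{u}\<^sup>\<bottom> = (span {u})\<^sup>\<bottom>"
  unfolding set_eq_iff orthogonal_comp_span_iff by (simp add: orthogonal_comp_def orthogonal_def)

lemma span_subset_orthogonal_comp_comp: "x \<in> span S \<Longrightarrow> x \<in> (span S)\<^sup>\<bottom>\<^sup>\<bottom>"
  using orthogonal_comp_subset by blast

lemma orth_proj_hyperplane:
  assumes "norm u = 1"
  shows "orth_proj ((span {u})\<^sup>\<bottom>) x = x - (x \<bullet> u) *\<^sub>R u"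
proof (rule orth_proj_eqI[OF subspace_orthogonal_comp])
  have "u \<bullet> u = 1" using assms by (simp add: norm_eq_1)
  then show "x - (x \<bullet> u) *\<^sub>R u \<in> (span {u})\<^sup>\<bottom>"
    by (simp add: orthogonal_comp_span_iff inner_diff_right inner_commute)
  show "x - (x - (x \<bullet> u) *\<^sub>R u) \<in> (span {u})\<^sup>\<bottom>\<^sup>\<bottom>"
    by (intro span_subset_orthogonal_comp_comp) (simp add: span_base span_scale)
qed

text \<open>Writing the projection as two successive projections along orthonormal directions allows
  \<open>measure_plus_segment_orthogonal\<close> to be applied twice.\<close>

lemma orth_proj_codim2:
  assumes "norm u = 1" "norm e = 1" "u \<bullet> e = 0"
  shows "orth_proj ((span {u, e})\<^sup>\<bottom>) x = (let y = x - (x \<bullet> u) *\<^sub>R u in y - (y \<bullet> e) *\<^sub>R e)"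
  unfolding Let_def
proof (rule orth_proj_eqI[OF subspace_orthogonal_comp])
  define y where "y = x - (x \<bullet> u) *\<^sub>R u"
  have 1: "u \<bullet> u = 1" "e \<bullet> e = 1" "e \<bullet> u = 0" using assms by (simp_all add: norm_eq_1 inner_commute)
  then have "u \<bullet> y = 0" by (simp add: y_def inner_diff_right inner_commute)
  with 1 assms(3) show "x - (x \<bullet> u) *\<^sub>R u - ((x - (x \<bullet> u) *\<^sub>R u) \<bullet> e) *\<^sub>R e \<in> (span {u, e})\<^sup>\<bottom>"
    unfolding y_def[symmetric]
    by (simp add: orthogonal_comp_span_iff inner_diff_right) (simp add: inner_commute)
  have "x - (y - (y \<bullet> e) *\<^sub>R e) = (x \<bullet> u) *\<^sub>R u + (y \<bullet> e) *\<^sub>R e" by (simp add: y_def)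
  also have "\<dots> \<in> (span {u, e})\<^sup>\<bottom>\<^sup>\<bottom>"
    by (intro span_subset_orthogonal_comp_comp span_add span_scale span_base) auto
  finally show "x - (x - (x \<bullet> u) *\<^sub>R u - ((x - (x \<bullet> u) *\<^sub>R u) \<bullet> e) *\<^sub>R e) \<in> (span {u, e})\<^sup>\<bottom>\<^sup>\<bottom>"
    by (simp add: y_def)
qed

text \<open>Both sides equal the volume of the shadow thickened by the unit segment along
  \<open>u\<close>: the left by \<open>vol_on_eq_measure_plus_cube\<close> with
  \<open>C = {u}\<close>, the right by \<open>measure_plus_segment_orthogonal\<close> with
  \<open>t = 1\<close>.\<close>

proposition vol_on_hyperplane_shadow:
  fixes A :: "'a::euclidean_space set"
  assumes A: "compact A" "convex A" and u: "norm u = 1"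
  shows "vol_on ({u}\<^sup>\<bottom>) (orth_proj ({u}\<^sup>\<bottom>) ` A)
       = measure lebesgue (A + closed_segment 0 u) - measure lebesgue A"
proof -
  define f where "f x = x - (x \<bullet> u) *\<^sub>R u" for x
  have f: "linear f" using linear_diff_inner_scaleR[of u] by (simp add: f_def[abs_def])
  have proj: "orth_proj ({u}\<^sup>\<bottom>) = f"
    by (simp add: fun_eq_iff f_def orthogonal_comp_singleton orth_proj_hyperplane[OF u])
  have "u \<bullet> u = 1" using u by (simp add: norm_eq_1)
  then have "f ` A \<subseteq> (span {u})\<^sup>\<bottom>"
    by (auto simp: f_def orthogonal_comp_span_iff inner_diff_right inner_commute)
  moreover have "compact (f ` A)"
    using A f by (intro compact_continuous_image linear_continuous_on) (auto simp: linear_linear)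
  ultimately have "vol_on ((span {u})\<^sup>\<bottom>) (f ` A) = measure lebesgue (f ` A + (\<Sum>c\<in>{u}. closed_segment 0 c))"
    using u by (intro vol_on_eq_measure_plus_cube) auto
  then show ?thesis
    using measure_plus_segment_orthogonal[OF A u, of 1] unfolding proj
    by (simp add: orthogonal_comp_singleton f_def[abs_def])
qed

text \<open>The right-hand side is a second difference. Taking the difference in \<open>u\<close>
  projects along \<open>u\<close> and turns the segment of \<open>v\<close> into that of
  \<open>p\<close>, the part of \<open>v\<close> orthogonal to \<open>u\<close>. Taking the
  difference in \<open>p\<close> projects once more and contributes the factor
  \<open>norm p\<close>, which is the square root on the left.\<close>

proposition vol_on_codim2_shadow:
  fixes A :: "'a::euclidean_space set"
  assumes A: "compact A" "convex A" and u: "norm u = 1" and v: "norm v = 1"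
  shows "vol_on ((span {u, v})\<^sup>\<bottom>) (orth_proj ((span {u, v})\<^sup>\<bottom>) ` A) * sqrt (1 - (u \<bullet> v)\<^sup>2)
       = measure lebesgue (A + closed_segment 0 u + closed_segment 0 v)
         - measure lebesgue (A + closed_segment 0 u) - measure lebesgue (A + closed_segment 0 v)
         + measure lebesgue A"
proof -
  define f where "f x = x - (x \<bullet> u) *\<^sub>R u" for x
  have f: "linear f" using linear_diff_inner_scaleR[of u] by (simp add: f_def[abs_def])
  have compact_image: "compact (g ` S)" if "linear g" "compact S" for g :: "'a \<Rightarrow> 'a" and S
    using that by (intro compact_continuous_image linear_continuous_on) (auto simp: linear_linear)
  have uu: "u \<bullet> u = 1" "v \<bullet> v = 1" using u v by (simp_all add: norm_eq_1)
  define p where "p = f v"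
  have "p \<bullet> p = 1 - (u \<bullet> v)\<^sup>2"
    using uu by (simp add: p_def f_def inner_diff_left inner_diff_right inner_commute power2_eq_square)
  then have norm_p: "norm p = sqrt (1 - (u \<bullet> v)\<^sup>2)" by (simp add: norm_eq_sqrt_inner)
  have up: "u \<bullet> p = 0" using uu by (simp add: p_def f_def inner_diff_right inner_commute)
  define K where "K = f ` A + closed_segment 0 u"
  have K: "compact K" "convex K"
    using A f by (auto simp: K_def compact_set_plus convex_set_plus compact_image convex_linear_image)
  have "f ` (A + closed_segment 0 v) = f ` A + closed_segment 0 p"
    using f closed_segment_linear_image[OF f, of 0 v] by (simp add: linear_image_set_plus p_def linear_0)
  then have "f ` (A + closed_segment 0 v) + closed_segment 0 u = K + closed_segment 0 p"
    by (simp add: K_def ac_simps)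
  moreover have "measure lebesgue (L + closed_segment 0 u) - measure lebesgue L = measure lebesgue (f ` L + closed_segment 0 u)"
    if "compact L" "convex L" for L
    using measure_plus_segment_orthogonal[OF that u, of 1] by (simp add: f_def[abs_def])
  from this[of A] this[of "A + closed_segment 0 v"]
  have "measure lebesgue (A + closed_segment 0 u) - measure lebesgue A = measure lebesgue K"
    "measure lebesgue (A + closed_segment 0 v + closed_segment 0 u) - measure lebesgue (A + closed_segment 0 v)
      = measure lebesgue (f ` (A + closed_segment 0 v) + closed_segment 0 u)"
    using A by (simp_all add: K_def compact_set_plus convex_set_plus)
  ultimately have mixed: "measure lebesgue (A + closed_segment 0 u + closed_segment 0 v)
         - measure lebesgue (A + closed_segment 0 u) - measure lebesgue (A + closed_segment 0 v)
         + measure lebesgue A = measure lebesgue (K + closed_segment 0 p) - measure lebesgue K"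
    by (simp add: add.assoc add.commute[of "closed_segment 0 v"])
  show ?thesis
  proof (cases "p = 0")
    \<comment> \<open>Here \<open>u\<close> and \<open>v\<close> are parallel: the square root is 0,
      and adding the segment of \<open>p\<close> changes nothing.\<close>
    case True
    then show ?thesis unfolding mixed norm_p[symmetric] by simp
  next
    case False
    define e where "e = p /\<^sub>R norm p"
    have e: "norm e = 1" "p = norm p *\<^sub>R e" using False by (auto simp: e_def)
    have ue: "u \<bullet> e = 0" using up by (simp add: e_def)
    define g where "g x = x - (x \<bullet> e) *\<^sub>R e" for x
    have g: "linear g" using linear_diff_inner_scaleR[of e] by (simp add: g_def[abs_def])
    have span: "span {u, v} = span {u, e}"
    proof (rule span_eq[THEN iffD2], intro conjI)
      have "v = p + (v \<bullet> u) *\<^sub>R u" by (simp add: p_def f_def)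
      then have "v = norm p *\<^sub>R e + (v \<bullet> u) *\<^sub>R u" using e(2) by simp
      moreover have "norm p *\<^sub>R e + (v \<bullet> u) *\<^sub>R u \<in> span {u, e}"
        by (intro span_add span_scale span_base) auto
      ultimately show "{u, v} \<subseteq> span {u, e}" by (simp add: span_base)
      have "e \<in> span {u, v}"
        unfolding e_def p_def f_def by (intro span_scale span_diff span_base) auto
      then show "{u, e} \<subseteq> span {u, v}" by (simp add: span_base)
    qed
    define B where "B = g ` f ` A"
    have B: "compact B" using A f g by (simp add: B_def compact_image)
    have "u \<noteq> e" using uu ue by auto
    have proj: "orth_proj ((span {u, v})\<^sup>\<bottom>) ` A = B"
      unfolding span B_def image_image using orth_proj_codim2[OF u e(1) ue]
      by (simp add: Let_def f_def g_def)
    have "e \<bullet> e = 1" "e \<bullet> u = 0" using e(1) ue by (simp_all add: norm_eq_1 inner_commute)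
    then have "B \<subseteq> (span {u, e})\<^sup>\<bottom>"
      using uu ue by (auto simp: B_def f_def g_def orthogonal_comp_span_iff inner_diff_right inner_diff_left inner_commute)
    then have "vol_on ((span {u, e})\<^sup>\<bottom>) B = measure lebesgue (B + (\<Sum>c\<in>{u, e}. closed_segment 0 c))"
      using B u e(1) ue \<open>e \<bullet> u = 0\<close>
      by (intro vol_on_eq_measure_plus_cube) (auto simp: pairwise_def orthogonal_def)
    also have "B + (\<Sum>c\<in>{u, e}. closed_segment 0 c) = g ` K + closed_segment 0 e"
    proof -
      \<comment> \<open>The second projection fixes \<open>u\<close>, so it carries the thickened
        first shadow \<open>K\<close> to the final shadow \<open>B\<close> thickened along
        \<open>u\<close>.\<close>
      have "g u = u" using ue by (simp add: g_def)
      then have "g ` closed_segment 0 u = closed_segment 0 u"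
        using closed_segment_linear_image[OF g, of 0 u] by (simp add: linear_0[OF g])
      then show ?thesis
        using \<open>u \<noteq> e\<close> g by (simp add: K_def B_def linear_image_set_plus add.assoc)
    qed
    finally have "vol_on ((span {u, v})\<^sup>\<bottom>) B = measure lebesgue (g ` K + closed_segment 0 e)"
      by (simp add: span)
    moreover have "measure lebesgue (K + closed_segment 0 p)
        = measure lebesgue K + norm p * measure lebesgue (g ` K + closed_segment 0 e)"
      using measure_plus_segment_orthogonal[OF K e(1), of "norm p"] e(2)
      by (simp add: g_def[abs_def])
    ultimately show ?thesis unfolding mixed proj norm_p[symmetric] by simp
  qed
qed

section \<open>Adding one or two segments to a parallelotope\<close>

context
  fixes I :: "'i set" and z :: "'i \<Rightarrow> 'a::euclidean_space" and p q :: 'i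
  assumes fin: "finite I" and card_I: "card I = DIM('a)"
    and p: "p \<notin> I" and q: "q \<notin> I" and pq: "p \<noteq> q"
begin

lemma zonotope_vol_expand: "finite J \<Longrightarrow> zonotope_vol J z = (\<Sum>S | S \<subseteq> J \<and> card S = DIM('a). zonotope_vol S z)"
  unfolding zonotope_vol_def by (rule zonotope_volume)

text \<open>The sets of \<open>DIM('a)\<close> indices that appear with \<open>r\<close> contain
  \<open>r\<close> and omit exactly one \<open>i\<close> from \<open>I\<close>, so
  \<open>z r\<close> takes over the slot of \<open>i\<close>.\<close>

lemma zonotope_vol_insert:
  assumes "r \<notin> I"
  shows "zonotope_vol (insert r I) z - zonotope_vol I z = (\<Sum>i\<in>I. zonotope_vol I (z(i := z r)))"
proof -
  define F where "F J = {S. S \<subseteq> J \<and> card S = DIM('a)}" for J :: "'i set"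
  have F: "finite (F (insert r I))" using fin by (simp add: F_def)
  have "F (insert r I) - F I = (\<lambda>i. insert r (I - {i})) ` I"
  proof (intro equalityI subsetI)
    fix S assume "S \<in> F (insert r I) - F I"
    then have S: "S \<subseteq> insert r I" "card S = card I" "r \<in> S" using card_I by (auto simp: F_def)
    then have "finite S" using fin finite_subset by auto
    with S fin have "card (S - {r}) = card I - 1" "card I > 0" by (auto simp: card_gt_0_iff)
    moreover have "S - {r} \<subseteq> I" using S by auto
    ultimately have "card (I - (S - {r})) = 1"
      using fin \<open>finite S\<close> by (subst card_Diff_subset) auto
    then obtain i where i: "I - (S - {r}) = {i}" by (auto simp: card_1_singleton_iff)
    have "S = insert r (I - {i})" using i S(1,3) assms by auto
    with i show "S \<in> (\<lambda>i. insert r (I - {i})) ` I" by auto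
  next
    fix S assume "S \<in> (\<lambda>i. insert r (I - {i})) ` I"
    then obtain i where "i \<in> I" "S = insert r (I - {i})" by blast
    then show "S \<in> F (insert r I) - F I"
      using fin assms card_I by (auto simp: F_def card.insert_remove card_Suc_Diff1)
  qed
  moreover have "inj_on (\<lambda>i. insert r (I - {i})) I"
    using assms by (auto simp: inj_on_def)
  moreover have "zonotope_vol (insert r (I - {i})) z = zonotope_vol I (z(i := z r))" if "i \<in> I" for i
    using fin that assms unfolding zonotope_vol_def by (simp add: sum.remove[of I i])
  ultimately have "(\<Sum>S\<in>F (insert r I) - F I. zonotope_vol S z) = (\<Sum>i\<in>I. zonotope_vol I (z(i := z r)))"
    by (simp add: sum.reindex)
  moreover have "(\<Sum>S\<in>F (insert r I) - F I. zonotope_vol S z) = zonotope_vol (insert r I) z - zonotope_vol I z"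
    using fin F zonotope_vol_expand[of "insert r I"] zonotope_vol_expand[of I]
    by (subst sum_diff) (auto simp: F_def)
  ultimately show ?thesis by simp
qed

text \<open>By inclusion-exclusion only the index sets containing both \<open>p\<close> and
  \<open>q\<close> survive. Each omits two elements of \<open>I\<close>, and these can be assigned
  to the slots of \<open>z p\<close> and \<open>z q\<close> in two orders with the same volume;
  hence the factor 2.\<close>

lemma zonotope_vol_insert2:
  "2 * (zonotope_vol (insert p (insert q I)) z - zonotope_vol (insert p I) z - zonotope_vol (insert q I) z + zonotope_vol I z)
   = (\<Sum>i\<in>I. \<Sum>j\<in>I - {i}. zonotope_vol I (z(i := z p, j := z q)))"
proof -
  define F where "F J = {S. S \<subseteq> J \<and> card S = DIM('a)}" for J :: "'i set"
  define G where "G = {S \<in> F (insert p (insert q I)). p \<in> S \<and> q \<in> S}"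
  define h where "h = (\<lambda>(i, j). insert p (insert q (I - {i, j})))"
  define P where "P = Sigma I (\<lambda>i. I - {i})"
  have finF: "finite (F J)" if "finite J" for J using that by (simp add: F_def)
  have vol: "zonotope_vol J z = (\<Sum>S\<in>F J. zonotope_vol S z)" if "finite J" for J
    unfolding F_def using that by (rule zonotope_vol_expand)
  have split: "F (insert p (insert q I)) = G \<union> (F (insert p I) \<union> (F (insert q I) - F I))"
    by (auto simp: G_def F_def)
  have fin_parts: "finite G" "finite (F (insert p I))" "finite (F (insert q I) - F I)" "finite (F (insert q I))"
    using fin by (simp_all add: G_def finF)
  have disjoint: "G \<inter> (F (insert p I) \<union> (F (insert q I) - F I)) = {}" "F (insert p I) \<inter> (F (insert q I) - F I) = {}"
    using p q pq by (auto simp: G_def F_def)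
  have "(\<Sum>S\<in>F (insert p (insert q I)). zonotope_vol S z)
      = (\<Sum>S\<in>G. zonotope_vol S z) + ((\<Sum>S\<in>F (insert p I). zonotope_vol S z)
        + (\<Sum>S\<in>F (insert q I) - F I. zonotope_vol S z))"
    unfolding split using fin_parts disjoint by (simp add: sum.union_disjoint)
  also have "(\<Sum>S\<in>F (insert q I) - F I. zonotope_vol S z)
      = (\<Sum>S\<in>F (insert q I). zonotope_vol S z) - (\<Sum>S\<in>F I. zonotope_vol S z)"
    using fin_parts by (intro sum_diff) (auto simp: F_def)
  finally have mixed: "zonotope_vol (insert p (insert q I)) z - zonotope_vol (insert p I) z - zonotope_vol (insert q I) z
      + zonotope_vol I z = (\<Sum>S\<in>G. zonotope_vol S z)"
    using fin by (simp add: vol)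
  \<comment> \<open>The fibre consists of the two orderings of the pair of indices missing from
    \<open>S\<close>.\<close>
  have fibre: "card {x \<in> P. h x = S} = 2" if S: "S \<in> G" for S
  proof -
    define R where "R = S - {p, q}"
    have SR: "S = insert p (insert q R)" "p \<notin> R" "q \<notin> R" "R \<subseteq> I"
      using S by (auto simp: R_def G_def F_def)
    then have "finite R" using fin finite_subset by blast
    moreover have "card S = card I" using S card_I by (simp add: G_def F_def)
    ultimately have "card (I - R) = 2"
      using SR pq fin card_Diff_subset[of R I] card_mono[of I R] by simp
    then obtain a b where ab: "I - R = {a, b}" "a \<noteq> b" by (auto simp: card_2_iff)
    have "{x \<in> P. h x = S} = {(a, b), (b, a)}"
    proof -
      have h_eq: "h (i, j) = S \<longleftrightarrow> I - {i, j} = R" if "i \<in> I" "j \<in> I" for i j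
        using p q SR by (auto simp: h_def)
      have R_eq: "I - {i, j} = R \<longleftrightarrow> {i, j} = {a, b}" if "i \<in> I" "j \<in> I" for i j
        using that ab SR(4) by blast
      have "a \<in> I" "b \<in> I" using ab by auto
      then have "(i, j) \<in> {x \<in> P. h x = S} \<longleftrightarrow> (i, j) \<in> {(a, b), (b, a)}" for i j
        using h_eq[of i j] R_eq[of i j] ab(2) by (auto simp: P_def doubleton_eq_iff)
      then show ?thesis unfolding set_eq_iff split_paired_All by blast
    qed
    with ab show ?thesis by simp
  qed
  have "h ` P \<subseteq> G"
  proof -
    have "h (i, j) \<in> G" if "i \<in> I" "j \<in> I" "i \<noteq> j" for i j
    proof -
      have "card (I - {i, j}) = card I - 2" "card I \<ge> 2"
        using that fin card_mono[of I "{i, j}"] by (auto simp: card_Diff_subset)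
      then show ?thesis
        using p q pq fin card_I by (auto simp: h_def G_def F_def)
    qed
    then show ?thesis by (auto simp: P_def)
  qed
  have "(\<Sum>i\<in>I. \<Sum>j\<in>I - {i}. zonotope_vol I (z(i := z p, j := z q))) = (\<Sum>x\<in>P. zonotope_vol (h x) z)"
  proof -
    have "zonotope_vol (h (i, j)) z = zonotope_vol I (z(i := z p, j := z q))" if "i \<in> I" "j \<in> I - {i}" for i j
    proof -
      have "(\<Sum>k\<in>I. closed_segment 0 ((z(i := z p, j := z q)) k))
          = closed_segment 0 (z p) + (closed_segment 0 (z q) + (\<Sum>k\<in>I - {i} - {j}. closed_segment 0 (z k)))"
        using that card_I by (intro sum_segments_upd2[OF fin]) auto
      also have "I - {i} - {j} = I - {i, j}" by auto
      also have "closed_segment 0 (z p) + (closed_segment 0 (z q) + (\<Sum>k\<in>I - {i, j}. closed_segment 0 (z k)))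
          = (\<Sum>k\<in>h (i, j). closed_segment 0 (z k))"
        using fin p q pq by (simp add: h_def)
      finally show ?thesis by (simp only: zonotope_vol_def)
    qed
    then have "(\<Sum>i\<in>I. \<Sum>j\<in>I - {i}. zonotope_vol I (z(i := z p, j := z q)))
        = (\<Sum>i\<in>I. \<Sum>j\<in>I - {i}. zonotope_vol (h (i, j)) z)"
      by (intro sum.cong refl) simp
    then show ?thesis
      using fin by (simp add: P_def sum.Sigma)
  qed
  also have "\<dots> = (\<Sum>S\<in>G. \<Sum>x | x \<in> P \<and> h x = S. zonotope_vol (h x) z)"
    using fin finF \<open>h ` P \<subseteq> G\<close> by (intro sum.group[symmetric]) (auto simp: P_def G_def)
  also have "\<dots> = (\<Sum>S\<in>G. 2 * zonotope_vol S z)"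
    using fibre by (intro sum.cong) auto
  finally show ?thesis unfolding mixed by (simp add: sum_distrib_left)
qed

context
  fixes x y :: "'i \<Rightarrow> real"
  assumes zp: "z p = (\<Sum>k\<in>I. x k *\<^sub>R z k)" and zq: "z q = (\<Sum>k\<in>I. y k *\<^sub>R z k)"
begin

lemma zonotope_vol_insert_coeffs:
  "zonotope_vol (insert p I) z - zonotope_vol I z = (\<Sum>i\<in>I. \<bar>x i\<bar>) * zonotope_vol I z"
  "zonotope_vol (insert q I) z - zonotope_vol I z = (\<Sum>i\<in>I. \<bar>y i\<bar>) * zonotope_vol I z"
  using zonotope_vol_insert[OF p] zonotope_vol_insert[OF q] card_I
  by (simp_all add: zp zq zonotope_vol_replace[OF fin] sum_distrib_right)

lemma zonotope_vol_insert2_coeffs: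
  "2 * (zonotope_vol (insert p (insert q I)) z - zonotope_vol (insert p I) z - zonotope_vol (insert q I) z + zonotope_vol I z)
   = (\<Sum>i\<in>I. \<Sum>j\<in>I. \<bar>x i * y j - x j * y i\<bar>) * zonotope_vol I z"
proof -
  have "(\<Sum>j\<in>I - {i}. zonotope_vol I (z(i := z p, j := z q))) = (\<Sum>j\<in>I. \<bar>x i * y j - x j * y i\<bar>) * zonotope_vol I z"
    if "i \<in> I" for i
  proof -
    have "(\<Sum>j\<in>I - {i}. zonotope_vol I (z(i := z p, j := z q)))
        = (\<Sum>j\<in>I - {i}. \<bar>x i * y j - x j * y i\<bar> * zonotope_vol I z)"
      using that card_I unfolding zp zq by (intro sum.cong refl zonotope_vol_replace2[OF fin]) auto
    \<comment> \<open>The diagonal term \<open>j = i\<close> can be included because its minor is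
      0.\<close>
    also have "\<dots> = (\<Sum>j\<in>I. \<bar>x i * y j - x j * y i\<bar> * zonotope_vol I z)"
      using that fin by (simp add: sum.remove[of I i])
    finally show ?thesis by (simp add: sum_distrib_right)
  qed
  then show ?thesis
    unfolding zonotope_vol_insert2 by (simp add: sum_distrib_right)
qed

end

end

section \<open>The inequality for parallelotopes\<close>

text \<open>The triangle inequality for each ordered pair, summed; the two products contribute
  equally by symmetry. Equality means that every defect \<open>d i j\<close> vanishes. The diagonal
  defects are twice \<open>\<bar>x i * y i\<bar>\<close>; conversely, if all
  \<open>x i * y i\<close> are 0, then for each pair at most one of \<open>x i * y j\<close> and
  \<open>x j * y i\<close> is nonzero.\<close>

lemma sum_abs_minors_le:
  fixes x y :: "'i \<Rightarrow> real"
  assumes "finite I"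
  shows "(\<Sum>i\<in>I. \<Sum>j\<in>I. \<bar>x i * y j - x j * y i\<bar>) \<le> 2 * ((\<Sum>i\<in>I. \<bar>x i\<bar>) * (\<Sum>i\<in>I. \<bar>y i\<bar>))"
    and "(\<Sum>i\<in>I. \<Sum>j\<in>I. \<bar>x i * y j - x j * y i\<bar>) = 2 * ((\<Sum>i\<in>I. \<bar>x i\<bar>) * (\<Sum>i\<in>I. \<bar>y i\<bar>))
      \<longleftrightarrow> (\<forall>i\<in>I. x i = 0 \<or> y i = 0)"
proof -
  define d where "d i j = \<bar>x i\<bar> * \<bar>y j\<bar> + \<bar>x j\<bar> * \<bar>y i\<bar> - \<bar>x i * y j - x j * y i\<bar>" for i j
  have d_nonneg: "d i j \<ge> 0" for i j
    using abs_triangle_ineq4[of "x i * y j" "x j * y i"] by (simp add: d_def abs_mult)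
  have "(\<Sum>i\<in>I. \<Sum>j\<in>I. \<bar>x j\<bar> * \<bar>y i\<bar>) = (\<Sum>i\<in>I. \<Sum>j\<in>I. \<bar>x i\<bar> * \<bar>y j\<bar>)"
    by (rule sum.swap)
  then have diff: "2 * ((\<Sum>i\<in>I. \<bar>x i\<bar>) * (\<Sum>i\<in>I. \<bar>y i\<bar>)) - (\<Sum>i\<in>I. \<Sum>j\<in>I. \<bar>x i * y j - x j * y i\<bar>)
      = (\<Sum>i\<in>I. \<Sum>j\<in>I. d i j)"
    by (simp add: d_def sum_product sum_subtractf sum.distrib)
  have "(\<Sum>i\<in>I. \<Sum>j\<in>I. d i j) \<ge> 0"
    using d_nonneg by (intro sum_nonneg)
  with diff show "(\<Sum>i\<in>I. \<Sum>j\<in>I. \<bar>x i * y j - x j * y i\<bar>) \<le> 2 * ((\<Sum>i\<in>I. \<bar>x i\<bar>) * (\<Sum>i\<in>I. \<bar>y i\<bar>))"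
    by linarith
  have "(\<Sum>i\<in>I. \<Sum>j\<in>I. d i j) = 0 \<longleftrightarrow> (\<forall>i\<in>I. \<forall>j\<in>I. d i j = 0)"
    using assms d_nonneg by (simp add: sum_nonneg_eq_0_iff sum_nonneg)
  also have "\<dots> \<longleftrightarrow> (\<forall>i\<in>I. x i = 0 \<or> y i = 0)"
  proof
    assume "\<forall>i\<in>I. \<forall>j\<in>I. d i j = 0"
    then have "\<forall>i\<in>I. d i i = 0" by blast
    then show "\<forall>i\<in>I. x i = 0 \<or> y i = 0" by (simp add: d_def)
  next
    assume "\<forall>i\<in>I. x i = 0 \<or> y i = 0"
    then show "\<forall>i\<in>I. \<forall>j\<in>I. d i j = 0"
      by (fastforce simp: d_def abs_mult)
  qed
  finally show "(\<Sum>i\<in>I. \<Sum>j\<in>I. \<bar>x i * y j - x j * y i\<bar>) = 2 * ((\<Sum>i\<in>I. \<bar>x i\<bar>) * (\<Sum>i\<in>I. \<bar>y i\<bar>))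
      \<longleftrightarrow> (\<forall>i\<in>I. x i = 0 \<or> y i = 0)"
    using diff by linarith
qed

lemma sum_translated_segments:
  fixes a w :: "'i \<Rightarrow> 'a::real_vector"
  assumes "finite I"
  shows "(\<Sum>i\<in>I. closed_segment (a i) (a i + w i)) = (+) (\<Sum>i\<in>I. a i) ` (\<Sum>i\<in>I. closed_segment 0 (w i))"
proof -
  have "closed_segment (a i) (a i + w i) = {a i} + closed_segment 0 (w i)" for i
    using closed_segment_translation[of "a i" 0 "w i"] by (auto simp: set_plus_def)
  moreover have "(\<Sum>i\<in>I. {a i}) = {\<Sum>i\<in>I. a i}"
    using assms by (induction I) (auto simp: set_plus_def)
  ultimately have "(\<Sum>i\<in>I. closed_segment (a i) (a i + w i)) = {\<Sum>i\<in>I. a i} + (\<Sum>i\<in>I. closed_segment 0 (w i))"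
    by (simp only: sum.distrib)
  then show ?thesis by (auto simp: set_plus_def)
qed

section \<open>Nonzero volume and bases\<close>

context
  fixes w :: "'n::finite \<Rightarrow> real ^ 'n"
  assumes vol: "zonotope_vol UNIV w \<noteq> 0"
begin

text \<open>Replacing \<open>w i\<close> by the vanishing combination multiplies the volume by
  \<open>\<bar>c i\<bar>\<close>, while a zero edge makes it 0.\<close>

lemma sum_scaleR_eq_0_imp:
  assumes "(\<Sum>k\<in>UNIV. c k *\<^sub>R w k) = 0"
  shows "c i = 0"
  using zonotope_vol_replace[where I = UNIV and w = w and i = i and x = c]
    zonotope_vol_scale[where I = UNIV and z = w and i = i and c = 0] vol by (simp add: assms)

lemma ex_coeffs: "\<exists>c. x = (\<Sum>k\<in>UNIV. c k *\<^sub>R w k)"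
proof -
  define L where "L c = (\<Sum>k\<in>UNIV. (c $ k) *\<^sub>R w k)" for c :: "real ^ 'n"
  have L: "linear L"
    by (auto intro!: linearI simp: L_def scaleR_add_left sum.distrib scaleR_sum_right)
  have "inj L"
    unfolding linear_injective_0[OF L]
  proof (intro allI impI)
    fix c assume "L c = 0"
    then have "c $ i = 0" for i unfolding L_def by (rule sum_scaleR_eq_0_imp)
    then show "c = 0" by (simp add: vec_eq_iff)
  qed
  with L have "surj L" by (rule linear_inj_imp_surj)
  then show ?thesis unfolding L_def surj_def by blast
qed

end

text \<open>The coefficient map of a basis is onto, hence open, so the parallelotope contains the
  nonempty open image of the open unit cube.\<close>

lemma zonotope_vol_pos:
  fixes w :: "'n::finite \<Rightarrow> real ^ 'n"
  assumes "inj w" "independent (range w)"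
  shows "zonotope_vol UNIV w > 0"
proof -
  define L where "L c = (\<Sum>k\<in>UNIV. (c $ k) *\<^sub>R w k)" for c :: "real ^ 'n"
  have L: "linear L"
    by (auto intro!: linearI simp: L_def scaleR_add_left sum.distrib scaleR_sum_right)
  have "card (range w) = DIM(real ^ 'n)"
    using assms(1) by (simp add: card_image)
  then have "dim (UNIV :: (real ^ 'n) set) \<le> card (range w)"
    by (metis dim_subset_UNIV)
  then have "span (range w) = UNIV"
    using assms(2) card_ge_dim_independent[of "range w" UNIV] by blast
  moreover have "span (range w) \<subseteq> range L"
  proof (rule span_minimal)
    have "L (axis i 1) = w i" for i
    proof -
      have "L (axis i 1) = (\<Sum>k\<in>UNIV. if k = i then w k else 0)"
        unfolding L_def by (intro sum.cong) (auto simp: axis_def)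
      then show ?thesis by simp
    qed
    then show "range w \<subseteq> range L" by (metis image_subsetI rangeI)
    show "subspace (range L)" using L by (simp add: linear_subspace_image)
  qed
  ultimately have "surj L" by auto
  have "open (L ` box 0 1)"
    using L \<open>surj L\<close> by (intro open_surjective_linear_image) auto
  moreover have "L ` box 0 1 \<noteq> {}"
    by (auto simp: box_ne_empty inner_Basis Basis_vec_def inner_axis)
  ultimately have "\<not> negligible (L ` box 0 1)" by (rule open_not_negligible)
  moreover have "L ` box 0 1 \<subseteq> (\<Sum>i\<in>UNIV. closed_segment 0 (w i))"
    unfolding sum_segments_eq[OF finite] L_def by (auto simp: mem_box_cart less_imp_le)
  ultimately have "\<not> negligible (\<Sum>i\<in>UNIV. closed_segment 0 (w i))"
    using negligible_subset by blast
  then show ?thesis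
    unfolding zonotope_vol_def
    by (simp add: negligible_iff_measure lmeasurable_compact compact_sum_segments zero_less_measure_iff)
qed

text \<open>The hypothesis is positive volume of \<open>A\<close>, a property of the set alone, so
  that the equality criterion applies to any representation of \<open>A\<close> by segments;
  independence of \<open>w\<close> is recovered from it.\<close>

proposition parallelotope_shadows:
  fixes a w :: "'n::finite \<Rightarrow> real ^ 'n" and u v :: "real ^ 'n"
  assumes A: "A = (\<Sum>i\<in>UNIV. closed_segment (a i) (a i + w i))" and pos: "measure lebesgue A > 0"
    and uv: "norm u = 1" "norm v = 1"
  defines "L \<equiv> measure lebesgue A * vol_on ((span {u, v})\<^sup>\<bottom>) (orth_proj ((span {u, v})\<^sup>\<bottom>) ` A) * sqrt (1 - (u \<bullet> v)\<^sup>2)"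
    and "R \<equiv> vol_on ({u}\<^sup>\<bottom>) (orth_proj ({u}\<^sup>\<bottom>) ` A) * vol_on ({v}\<^sup>\<bottom>) (orth_proj ({v}\<^sup>\<bottom>) ` A)"
  shows "L \<le> R"
    and "L = R \<longleftrightarrow> (\<exists>I c. u = (\<Sum>i\<in>I. c i *\<^sub>R w i) \<and> v = (\<Sum>i\<in>-I. c i *\<^sub>R w i))" (is "_ \<longleftrightarrow> ?E")
proof -
  \<comment> \<open>A disjoint sum as index type keeps the segments of \<open>u\<close> and
    \<open>v\<close> apart from each other and from those of \<open>w\<close>, even when some of
    these vectors coincide.\<close>
  define z where "z = case_sum w (\<lambda>b. if b then u else v)"
  define J where "J = range (Inl :: 'n \<Rightarrow> 'n + bool)"
  define p q :: "'n + bool" where "p = Inr True" and "q = Inr False"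
  have J: "finite J" "card J = DIM(real ^ 'n)" "p \<notin> J" "q \<notin> J" "p \<noteq> q"
    by (auto simp: J_def p_def q_def card_image)
  have z: "z p = u" "z q = v" "\<And>i. z (Inl i) = w i" by (simp_all add: z_def p_def q_def)
  have sum_J: "(\<Sum>k\<in>J. g k) = (\<Sum>i\<in>UNIV. g (Inl i))" for g :: "'n + bool \<Rightarrow> 'c::comm_monoid_add"
    unfolding J_def by (simp add: sum.reindex)
  define Z where "Z = (\<Sum>i\<in>UNIV. closed_segment 0 (w i))"
  have translate: "measure lebesgue (A + C) = measure lebesgue (Z + C)" for C
  proof -
    have "A + C = (+) (\<Sum>i\<in>UNIV. a i) ` (Z + C)"
      unfolding A Z_def sum_translated_segments[OF finite]
      by (force simp: set_plus_def add.assoc)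
    then show ?thesis by (simp add: measure_translation)
  qed
  have ZJ: "(\<Sum>k\<in>J. closed_segment 0 (z k)) = Z" by (simp add: sum_J z Z_def)
  define V where "V = zonotope_vol J z"
  have V: "measure lebesgue A = V"
    using translate[of "{0}"] by (simp add: V_def zonotope_vol_def ZJ)
  have Au: "measure lebesgue (A + closed_segment 0 u) = zonotope_vol (insert p J) z"
    using J by (simp add: zonotope_vol_def ZJ z translate add.commute)
  have Av: "measure lebesgue (A + closed_segment 0 v) = zonotope_vol (insert q J) z"
    using J by (simp add: zonotope_vol_def ZJ z translate add.commute)
  have Auv: "measure lebesgue (A + closed_segment 0 u + closed_segment 0 v) = zonotope_vol (insert p (insert q J)) z"
    using J by (simp add: zonotope_vol_def ZJ z translate add.assoc ac_simps)
  have "zonotope_vol UNIV w = V" by (simp add: V_def zonotope_vol_def sum_J z)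
  with pos V have w: "zonotope_vol UNIV w \<noteq> 0" by simp
  obtain x y where x: "u = (\<Sum>k\<in>UNIV. x k *\<^sub>R w k)" and y: "v = (\<Sum>k\<in>UNIV. y k *\<^sub>R w k)"
    using ex_coeffs[OF w] by metis
  have unique: "c = d" if "(\<Sum>k\<in>UNIV. c k *\<^sub>R w k) = (\<Sum>k\<in>UNIV. d k *\<^sub>R w k)" for c d
  proof
    fix i
    have "(\<Sum>k\<in>UNIV. (c k - d k) *\<^sub>R w k) = 0"
      using that by (simp add: scaleR_diff_left sum_subtractf)
    from sum_scaleR_eq_0_imp[OF w this] show "c i = d i" by simp
  qed
  define X Y :: "'n + bool \<Rightarrow> real" where "X = case_sum x (\<lambda>_. 0)" and "Y = case_sum y (\<lambda>_. 0)"
  have "z p = (\<Sum>k\<in>J. X k *\<^sub>R z k)" "z q = (\<Sum>k\<in>J. Y k *\<^sub>R z k)"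
    by (simp_all add: sum_J z X_def Y_def flip: x y)
  note coeffs = zonotope_vol_insert_coeffs[OF J this] zonotope_vol_insert2_coeffs[OF J this]
  define S where "S = (\<Sum>i\<in>UNIV. \<Sum>j\<in>UNIV. \<bar>x i * y j - x j * y i\<bar>)"
  define P where "P = (\<Sum>i\<in>UNIV. \<bar>x i\<bar>) * (\<Sum>i\<in>UNIV. \<bar>y i\<bar>)"
  have cA: "compact A" "convex A"
    unfolding A by (rule compact_sum_segments convex_sum_segments)+
  have R: "R = P * V\<^sup>2"
    using coeffs(1,2) unfolding R_def vol_on_hyperplane_shadow[OF cA uv(1)] vol_on_hyperplane_shadow[OF cA uv(2)] Au Av V
    by (simp add: sum_J X_def Y_def V_def P_def power2_eq_square ac_simps)
  \<comment> \<open>The doubled form matches \<open>zonotope_vol_insert2_coeffs\<close>, where each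
    unordered pair is counted twice.\<close>
  have "2 * L = V * (2 * (vol_on ((span {u, v})\<^sup>\<bottom>) (orth_proj ((span {u, v})\<^sup>\<bottom>) ` A) * sqrt (1 - (u \<bullet> v)\<^sup>2)))"
    by (simp add: L_def V)
  also have "\<dots> = S * V\<^sup>2"
    using coeffs(3) unfolding vol_on_codim2_shadow[OF cA uv] Au Av Auv V
    by (simp add: sum_J X_def Y_def V_def S_def power2_eq_square)
  finally have L: "2 * L = S * V\<^sup>2" .
  have V2: "V\<^sup>2 > 0" using pos V by simp
  have "S * V\<^sup>2 \<le> (2 * P) * V\<^sup>2"
    using sum_abs_minors_le(1)[of UNIV x y] V2 by (intro mult_right_mono) (auto simp: S_def P_def)
  then show "L \<le> R" using L R by linarith
  have "L = R \<longleftrightarrow> S * V\<^sup>2 = (2 * P) * V\<^sup>2" using L R by linarith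
  also have "\<dots> \<longleftrightarrow> S = 2 * P" using V2 by simp
  also have "\<dots> \<longleftrightarrow> (\<forall>i. x i = 0 \<or> y i = 0)"
    using sum_abs_minors_le(2)[of UNIV x y] by (simp add: S_def P_def)
  also have "\<dots> \<longleftrightarrow> ?E"
  proof
    assume xy: "\<forall>i. x i = 0 \<or> y i = 0"
    \<comment> \<open>\<open>I\<close> is the support of \<open>u\<close> in the basis
      \<open>w\<close>; by \<open>xy\<close> the coefficients of \<open>v\<close> live on its
      complement, so one function \<open>c\<close> serves both.\<close>
    define I where "I = {i. x i \<noteq> 0}"
    define c where "c i = (if i \<in> I then x i else y i)" for i
    have "u = (\<Sum>i\<in>I. c i *\<^sub>R w i)"
      unfolding x by (intro sum.mono_neutral_cong_right) (auto simp: I_def c_def)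
    moreover have "v = (\<Sum>i\<in>-I. c i *\<^sub>R w i)"
      unfolding y using xy by (intro sum.mono_neutral_cong_right) (auto simp: I_def c_def)
    ultimately show ?E by blast
  next
    assume ?E
    then obtain I c where Ic: "u = (\<Sum>i\<in>I. c i *\<^sub>R w i)" "v = (\<Sum>i\<in>-I. c i *\<^sub>R w i)" by blast
    have "(\<Sum>k\<in>UNIV. (if k \<in> K then c k else 0) *\<^sub>R w k) = (\<Sum>i\<in>K. c i *\<^sub>R w i)" for K
      by (intro sum.mono_neutral_cong_right) auto
    from this[of I] this[of "-I"] Ic x y have "x = (\<lambda>k. if k \<in> I then c k else 0)" "y = (\<lambda>k. if k \<in> -I then c k else 0)"
      by (intro unique; simp)+
    then show "\<forall>i. x i = 0 \<or> y i = 0" by simp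
  qed
  finally show "L = R \<longleftrightarrow> ?E" .
qed

theorem theorem4p2:
  fixes A :: "(real ^ 'n) set" and u v :: "real ^ 'n"
  assumes "CARD('n) \<ge> 2"
    and "parallelotope A"
    and "u \<in> sphere 0 1" and "v \<in> sphere 0 1"
  shows "measure lborel A * vol_on ((span {u, v})\<^sup>\<bottom>) (orth_proj ((span {u, v})\<^sup>\<bottom>) ` A)
             * sqrt (1 - (u \<bullet> v)\<^sup>2)
           \<le> vol_on ({u}\<^sup>\<bottom>) (orth_proj ({u}\<^sup>\<bottom>) ` A) * vol_on ({v}\<^sup>\<bottom>) (orth_proj ({v}\<^sup>\<bottom>) ` A)
       \<and> (\<forall>a w :: 'n \<Rightarrow> real ^ 'n.
            A = (\<Sum>i\<in>UNIV. closed_segment (a i) (a i + w i)) \<longrightarrow>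
            (measure lborel A * vol_on ((span {u, v})\<^sup>\<bottom>) (orth_proj ((span {u, v})\<^sup>\<bottom>) ` A)
                 * sqrt (1 - (u \<bullet> v)\<^sup>2)
               = vol_on ({u}\<^sup>\<bottom>) (orth_proj ({u}\<^sup>\<bottom>) ` A) * vol_on ({v}\<^sup>\<bottom>) (orth_proj ({v}\<^sup>\<bottom>) ` A)
             \<longleftrightarrow> (\<exists>(I :: 'n set) (c :: 'n \<Rightarrow> real).
                   u = (\<Sum>i\<in>I. c i *\<^sub>R w i) \<and> v = (\<Sum>i\<in>-I. c i *\<^sub>R w i))))"
proof -
  have uv: "norm u = 1" "norm v = 1" using assms(3,4) by auto
  obtain a w :: "'n \<Rightarrow> real ^ 'n" where w: "inj w" "independent (range w)"
    and A: "A = (\<Sum>i\<in>UNIV. closed_segment (a i) (a i + w i))"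
    using assms(2) unfolding parallelotope_def by blast
  have "compact A" unfolding A by (rule compact_sum_segments)
  then have lborel: "measure lborel A = measure lebesgue A"
    by (simp add: measure_completion borel_compact)
  have "measure lebesgue A = zonotope_vol UNIV w"
    unfolding A sum_translated_segments[OF finite] by (simp add: measure_translation zonotope_vol_def)
  with zonotope_vol_pos[OF w] have pos: "measure lebesgue A > 0" by simp
  \<comment> \<open>One independent representation gives the positive volume; the equality criterion
    is then applied to every other representation of the same set.\<close>
  show ?thesis
    unfolding lborel using parallelotope_shadows[OF A pos uv] parallelotope_shadows(2)[OF _ pos uv] by blast
qed

end
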